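(* Assume that $d^\pi(s)>0$ for all $s\in\mathcal S$ and all $\pi\in\operatorname{int}(\Delta_{\mathcal A}^{\mathcal S})$. Let $\psi\colon\Delta_{\mathcal A}\to\mathbb R$ be strictly convex and twice continuously differentiable on $\operatorname{int}(\Delta_{\mathcal A})$ with $v^\top\nabla^2\psi(p)v>0$ for all $0\neq v\in T\Delta_{\mathcal A}$, $p\in\operatorname{int}(\Delta_{\mathcal A})$. Let $R^\star=\max_\pi R(\pi)$, $\Pi^\star=\{\pi\in\Delta_{\mathcal A}^{\mathcal S}:R(\pi)=R^\star\}$ and fix $\pi_0\in\operatorname{int}(\Delta_{\mathcal A}^{\mathcal S})$. Then: 1. (Well-posedness) The gradient flow $\partial_t\pi_t=\nabla^\psi R(\pi_t)$ in $\operatorname{int}(\Delta_{\mathcal A}^{\mathcal S})$ started at $\pi_0$ admits a unique local solution $(\pi_t)_{t\in[0,T)}$. 2. (Central path property) For all $t\in(0,T)$, $\ \pi_t=\operatorname*{arg\,max}_{\pi\in\Delta_{\mathcal A}^{\mathcal S}}\{R(\pi)-t^{-1}D_\Psi(\pi,\pi_0)\}$. 3. (Sublinear convergence) For all $t\in(0,T)$, $$0\le R^\star-R(\pi_t)\le\frac{\min_{\pi^\star\in\Pi^\star}D_\Psi(\pi^\star,\pi_0)-D_\Psi(\pi_t,\pi_0)}{t}\le\frac{\min_{\pi^\star\in\Pi^\star}D_\Psi(\pi^\star,\pi_0)}{t}.$$ 4. (Implicit bias) If the solution exists for all times ($T=+\infty$), then $(\pi_t)_{t\ge0}$ converges and 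$$\lim_{t\to+\infty}\pi_t=\pi^\star=\operatorname*{arg\,min}_{\pi\in\Pi^\star}D_\Psi(\pi,\pi_0).$$
   Context: $\mathcal S$ (states) and $\mathcal A$ (actions) are finite nonempty sets. For a finite set $X$, $\Delta_X$ is the simplex of probability vectors on $X$; $T\Delta_{\mathcal A}=\{v\in\mathbb R^{\mathcal A}:\sum_av(a)=0\}$. A policy is an element $\pi\in\Delta_{\mathcal A}^{\mathcal S}$ with entries $\pi(a|s)$; write $\pi_s=\pi(\cdot|s)\in\Delta_{\mathcal A}$. $\operatorname{int}$ is the relative interior (all entries positive); $T\Delta_{\mathcal A}^{\mathcal S}=\{w\in\mathbb R^{\mathcal S\times\mathcal A}:\sum_aw(s,a)=0\ \forall s\}$, and $w_s=w(s,\cdot)$. Fixed data: a transition kernel $P(s'|s,a)$, a reward vector $r\in\mathbb R^{\mathcal S\times\mathcal A}$, $\gamma\in[0,1)$, an initial distribution $\mu\in\Delta_{\mathcal S}$. Under $\pi$ the process is $S_0\sim\mu$, $A_t\sim\pi(\cdot|S_t)$, $S_{t+1}\sim P(\cdot|S_t,A_t)$, with law $\mathbb P^{\pi,\mu}$. Define $R(\pi)=(1-\gamma)\,\mathbb E_{\mathbb P^{\pi,\mu}}[\sum_{t\ge0}\gamma^tr(S_t,A_t)]$ and $d^\pi(s)=(1-\gamma)\sum_{t\ge0}\gamma^t\,\mathbb P^{\pi,\mu}(S_t=s)$. The Riemannian metric associated with $\psi$ on $\operatorname{int}(\Delta_{\mathcal A}^{\mathcal S})$ is $g^\psi_\pi(u,w)=\sum_sd^\pi(s)\,u_s^\top\nabla^2\psi(\pi_s)w_s$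 for $u,w\in T\Delta_{\mathcal A}^{\mathcal S}$ (derivatives of $\psi$ are taken along $\Delta_{\mathcal A}$), and $\nabla^\psi R(\pi)\in T\Delta_{\mathcal A}^{\mathcal S}$ is the gradient of $R$ with respect to $g^\psi$. $D_\psi(p,q)=\psi(p)-\psi(q)-\nabla\psi(q)^\top(p-q)$ is the Bregman divergence of $\psi$, and $D_\Psi(\pi_1,\pi_2)=\sum_sd^{\pi_1}(s)\,D_\psi(\pi_1(\cdot|s),\pi_2(\cdot|s))$.
   Formalization: For existence of the min in 3 and for part 4, ψ is also assumed continuous on all of Δ_A (without this both can fail; 3 is otherwise stated with inf). In 4 the arg min is unique only at states s with d^{π*}(s)>0, since D_Ψ ignores unvisited states. *)

theory Defs
  imports "HOL-Probability.Probability"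
begin

text \<open>
  States and actions are finite types \<open>'s\<close> and \<open>'a\<close>. A vector in \<open>\<real>\<^sup>S\<^sup>\<times>\<^sup>A\<close>, in particular a policy, is a
  \<open>real ^ 'a ^ 's\<close>, with \<open>\<pi> $ s\<close> the action distribution in state \<open>s\<close>.
\<close>

section \<open>Simplices and policies\<close>

definition prob_simplex :: "(real ^ 'a::finite) set" where
  "prob_simplex = {p. (\<forall>a. 0 \<le> p $ a) \<and> (\<Sum>a\<in>UNIV. p $ a) = 1}"

definition int_simplex :: "(real ^ 'a::finite) set" where
  "int_simplex = {p. (\<forall>a. 0 < p $ a) \<and> (\<Sum>a\<in>UNIV. p $ a) = 1}"

definition tangent_simplex :: "(real ^ 'a::finite) set" where
  "tangent_simplex = {v. (\<Sum>a\<in>UNIV. v $ a) = 0}"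

definition policies :: "(real ^ 'a::finite ^ 's::finite) set" where
  "policies = {\<pi>. \<forall>s. \<pi> $ s \<in> prob_simplex}"

definition int_policies :: "(real ^ 'a::finite ^ 's::finite) set" where
  "int_policies = {\<pi>. \<forall>s. \<pi> $ s \<in> int_simplex}"

definition tangent_policies :: "(real ^ 'a::finite ^ 's::finite) set" where
  "tangent_policies = {w. \<forall>s. w $ s \<in> tangent_simplex}"

section \<open>The Markov decision process\<close>

text \<open>
  \<open>P s a\<close> is the law of the next state and \<open>\<mu>\<close> the initial law. For \<open>\<pi>\<close> outside \<open>policies\<close> the
  \<open>embed_pmf\<close> below, and hence everything built on it, is unspecified; it is only ever used on
  \<open>policies\<close>.
\<close>

definition act_pmf :: "real ^ 'a::finite ^ 's::finite \<Rightarrow> 's \<Rightarrow> ('s \<times> 'a) pmf" where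
  "act_pmf \<pi> s = map_pmf (Pair s) (embed_pmf (\<lambda>a. \<pi> $ s $ a))"

text \<open>The conditional law of \<open>(S\<^sub>t, A\<^sub>t)\<close> given the earlier state-action pairs \<open>\<omega> 0, \<dots>, \<omega> (t - 1)\<close>.\<close>

definition step_kernel ::
  "('s::finite \<Rightarrow> 'a::finite \<Rightarrow> 's pmf) \<Rightarrow> 's pmf \<Rightarrow> real ^ 'a ^ 's \<Rightarrow> nat \<Rightarrow> (nat \<Rightarrow> 's \<times> 'a) \<Rightarrow> ('s \<times> 'a) measure"
where
  "step_kernel P \<mu> \<pi> t \<omega> = measure_pmf (case t of
     0 \<Rightarrow> bind_pmf \<mu> (act_pmf \<pi>)
   | Suc k \<Rightarrow> bind_pmf (P (fst (\<omega> k)) (snd (\<omega> k))) (act_pmf \<pi>))"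

lemma Ionescu_Tulcea_step_kernel:
  "Ionescu_Tulcea (step_kernel P \<mu> \<pi>) (\<lambda>_. count_space UNIV)"
proof (rule Ionescu_Tulcea.intro)
  fix t
  show "step_kernel P \<mu> \<pi> t \<in> measurable (PiM {0..<t} (\<lambda>_. count_space UNIV)) (subprob_algebra (count_space UNIV))"
  proof (cases t)
    case 0
    have "step_kernel P \<mu> \<pi> 0 = (\<lambda>_. measure_pmf (bind_pmf \<mu> (act_pmf \<pi>)))"
      by (simp add: step_kernel_def fun_eq_iff)
    with 0 show ?thesis
      by (simp add: measurable_const measure_pmf_in_subprob_algebra)
  next
    case (Suc k)
    have 1: "(\<lambda>z. measure_pmf (bind_pmf (P (fst z) (snd z)) (act_pmf \<pi>)))
        \<in> measurable (count_space UNIV) (subprob_algebra (count_space UNIV))"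
      by (simp add: measure_pmf_in_subprob_algebra)
    have 2: "(\<lambda>\<omega>. \<omega> k) \<in> measurable (PiM {0..<t} (\<lambda>_. count_space UNIV)) (count_space UNIV)"
      using Suc by (intro measurable_component_singleton) auto
    show ?thesis
      using measurable_comp[OF 2 1] by (simp add: step_kernel_def[abs_def] Suc comp_def)
  qed
qed (simp add: step_kernel_def prob_space_measure_pmf)

text \<open>The law of the trajectory \<open>(S\<^sub>t, A\<^sub>t)\<^sub>t\<close> on the infinite product space, by Ionescu-Tulcea.\<close>

definition trajectory_law ::
  "('s::finite \<Rightarrow> 'a::finite \<Rightarrow> 's pmf) \<Rightarrow> 's pmf \<Rightarrow> real ^ 'a ^ 's \<Rightarrow> (nat \<Rightarrow> 's \<times> 'a) measure"
where
  "trajectory_law P \<mu> \<pi> = projective_family.lim UNIV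
     (Ionescu_Tulcea.CI (step_kernel P \<mu> \<pi>) (\<lambda>_. count_space UNIV)) (\<lambda>_. count_space UNIV)"

lemma prob_space_trajectory_law: "prob_space (trajectory_law P \<mu> \<pi>)"
proof -
  interpret IT: Ionescu_Tulcea "step_kernel P \<mu> \<pi>" "\<lambda>_. count_space UNIV"
    by (rule Ionescu_Tulcea_step_kernel)
  have J: "finite ({} :: nat set)" by simp
  have "prob_space (distr IT.PF.lim (PiM {} (\<lambda>_. count_space UNIV)) (\<lambda>x. restrict x {}))"
    unfolding IT.distr_lim[OF J] by (rule IT.PF.prob_space_P) simp_all
  then show ?thesis
    unfolding trajectory_law_def
    by (rule prob_space_distrD[rotated])
       (auto simp: measurable_cong_sets[OF IT.PF.sets_lim] intro!: measurable_restrict)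
qed

definition total_reward ::
  "('s::finite \<Rightarrow> 'a::finite \<Rightarrow> 's pmf) \<Rightarrow> real ^ 'a ^ 's \<Rightarrow> real \<Rightarrow> 's pmf \<Rightarrow> real ^ 'a ^ 's \<Rightarrow> real"
where
  "total_reward P r \<gamma> \<mu> \<pi> =
     (1 - \<gamma>) * (\<integral>\<omega>. (\<Sum>t. \<gamma> ^ t * r $ fst (\<omega> t) $ snd (\<omega> t)) \<partial>trajectory_law P \<mu> \<pi>)"

definition state_occupancy ::
  "('s::finite \<Rightarrow> 'a::finite \<Rightarrow> 's pmf) \<Rightarrow> real \<Rightarrow> 's pmf \<Rightarrow> real ^ 'a ^ 's \<Rightarrow> 's \<Rightarrow> real"
where
  "state_occupancy P \<gamma> \<mu> \<pi> s =
     (1 - \<gamma>) * (\<Sum>t. \<gamma> ^ t *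
       measure (trajectory_law P \<mu> \<pi>) {\<omega> \<in> space (trajectory_law P \<mu> \<pi>). fst (\<omega> t) = s})"

definition opt_reward ::
  "('s::finite \<Rightarrow> 'a::finite \<Rightarrow> 's pmf) \<Rightarrow> real ^ 'a ^ 's \<Rightarrow> real \<Rightarrow> 's pmf \<Rightarrow> real"
where
  "opt_reward P r \<gamma> \<mu> = (SUP \<pi>\<in>policies. total_reward P r \<gamma> \<mu> \<pi>)"

definition opt_policies ::
  "('s::finite \<Rightarrow> 'a::finite \<Rightarrow> 's pmf) \<Rightarrow> real ^ 'a ^ 's \<Rightarrow> real \<Rightarrow> 's pmf \<Rightarrow> (real ^ 'a ^ 's) set"
where
  "opt_policies P r \<gamma> \<mu> = {\<pi> \<in> policies. total_reward P r \<gamma> \<mu> \<pi> = opt_reward P r \<gamma> \<mu>}"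

section \<open>The potential and its derivatives along the simplex\<close>

definition strictly_convex_on :: "'v::real_vector set \<Rightarrow> ('v \<Rightarrow> real) \<Rightarrow> bool" where
  "strictly_convex_on S f \<longleftrightarrow> convex S \<and>
     (\<forall>x\<in>S. \<forall>y\<in>S. \<forall>u. x \<noteq> y \<longrightarrow> 0 < u \<longrightarrow> u < 1 \<longrightarrow>
        f ((1 - u) *\<^sub>R x + u *\<^sub>R y) < (1 - u) * f x + u * f y)"

text \<open>
  Derivatives are taken within \<open>int_simplex\<close>, so they depend only on the values of \<open>\<psi>\<close> there. A
  derivative within \<open>int_simplex\<close> is uniquely determined on \<open>tangent_simplex\<close> only, and is only
  evaluated on such directions.
\<close>

definition simplex_deriv :: "(real ^ 'a::finite \<Rightarrow> real) \<Rightarrow> real ^ 'a \<Rightarrow> real ^ 'a \<Rightarrow> real" where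
  "simplex_deriv \<psi> q v = frechet_derivative \<psi> (at q within int_simplex) v"

definition simplex_hess ::
  "(real ^ 'a::finite \<Rightarrow> real) \<Rightarrow> real ^ 'a \<Rightarrow> real ^ 'a \<Rightarrow> real ^ 'a \<Rightarrow> real"
where
  "simplex_hess \<psi> q u v =
     frechet_derivative (\<lambda>p. simplex_deriv \<psi> p v) (at q within int_simplex) u"

definition C2_on_int_simplex :: "(real ^ 'a::finite \<Rightarrow> real) \<Rightarrow> bool" where
  "C2_on_int_simplex \<psi> \<longleftrightarrow>
     \<psi> differentiable_on int_simplex \<and>
     (\<forall>v\<in>tangent_simplex. (\<lambda>p. simplex_deriv \<psi> p v) differentiable_on int_simplex) \<and>
     (\<forall>u\<in>tangent_simplex. \<forall>v\<in>tangent_simplex.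
        continuous_on int_simplex (\<lambda>p. simplex_hess \<psi> p u v))"

definition bregman :: "(real ^ 'a::finite \<Rightarrow> real) \<Rightarrow> real ^ 'a \<Rightarrow> real ^ 'a \<Rightarrow> real" where
  "bregman \<psi> p q = \<psi> p - \<psi> q - simplex_deriv \<psi> q (p - q)"

definition policy_div ::
  "('s::finite \<Rightarrow> 'a::finite \<Rightarrow> 's pmf) \<Rightarrow> real \<Rightarrow> 's pmf \<Rightarrow> (real ^ 'a \<Rightarrow> real) \<Rightarrow>
   real ^ 'a ^ 's \<Rightarrow> real ^ 'a ^ 's \<Rightarrow> real"
where
  "policy_div P \<gamma> \<mu> \<psi> \<pi>1 \<pi>2 =
     (\<Sum>s\<in>UNIV. state_occupancy P \<gamma> \<mu> \<pi>1 s * bregman \<psi> (\<pi>1 $ s) (\<pi>2 $ s))"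

section \<open>Riemannian gradient and gradient flow\<close>

definition policy_metric ::
  "('s::finite \<Rightarrow> 'a::finite \<Rightarrow> 's pmf) \<Rightarrow> real \<Rightarrow> 's pmf \<Rightarrow> (real ^ 'a \<Rightarrow> real) \<Rightarrow>
   real ^ 'a ^ 's \<Rightarrow> real ^ 'a ^ 's \<Rightarrow> real ^ 'a ^ 's \<Rightarrow> real"
where
  "policy_metric P \<gamma> \<mu> \<psi> \<pi> u w =
     (\<Sum>s\<in>UNIV. state_occupancy P \<gamma> \<mu> \<pi> s * simplex_hess \<psi> (\<pi> $ s) (u $ s) (w $ s))"

definition policy_gradient ::
  "('s::finite \<Rightarrow> 'a::finite \<Rightarrow> 's pmf) \<Rightarrow> real ^ 'a ^ 's \<Rightarrow> real \<Rightarrow> 's pmf \<Rightarrow> (real ^ 'a \<Rightarrow> real) \<Rightarrow>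
   real ^ 'a ^ 's \<Rightarrow> real ^ 'a ^ 's"
where
  "policy_gradient P r \<gamma> \<mu> \<psi> \<pi> =
     (THE v. v \<in> tangent_policies \<and>
        (\<forall>w\<in>tangent_policies. policy_metric P \<gamma> \<mu> \<psi> \<pi> v w =
           frechet_derivative (total_reward P r \<gamma> \<mu>) (at \<pi> within int_policies) w))"

text \<open>The time horizon \<open>T\<close> is an extended real, \<open>T = \<infinity>\<close> meaning a solution on \<open>[0, \<infinity>)\<close>.\<close>

definition gradient_flow ::
  "('s::finite \<Rightarrow> 'a::finite \<Rightarrow> 's pmf) \<Rightarrow> real ^ 'a ^ 's \<Rightarrow> real \<Rightarrow> 's pmf \<Rightarrow> (real ^ 'a \<Rightarrow> real) \<Rightarrow>
   real ^ 'a ^ 's \<Rightarrow> ereal \<Rightarrow> (real \<Rightarrow> real ^ 'a ^ 's) \<Rightarrow> bool"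
where
  "gradient_flow P r \<gamma> \<mu> \<psi> \<pi>\<^sub>0 T x \<longleftrightarrow>
     0 < T \<and> x 0 = \<pi>\<^sub>0 \<and>
     (\<forall>t. 0 \<le> t \<and> ereal t < T \<longrightarrow>
        x t \<in> int_policies \<and>
        (x has_vector_derivative policy_gradient P r \<gamma> \<mu> \<psi> (x t))
          (at t within {t. 0 \<le> t \<and> ereal t < T}))"

end

theory Submission
  imports Defs
begin

text \<open>
  The four claims rest on one identity. Write \<open>Q\<close> for the state-action value function of a policy and
  \<open>d\<close> for its state occupancy. The performance difference formula
    \<open>R \<pi>' - R \<pi> = (\<Sum>s. d\<^sub>\<pi>\<^sub>' s * ((\<pi>'\<^sub>s - \<pi>\<^sub>s) \<bullet> Q\<^sub>\<pi> s))\<close>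
  (\<open>performance_difference\<close>) shows that the derivative of \<open>R\<close> at \<open>\<pi>\<close> in direction \<open>w\<close> is
  \<open>\<Sum>s. d\<^sub>\<pi> s * (w\<^sub>s \<bullet> Q\<^sub>\<pi> s)\<close>. The metric carries the same weights, so they cancel: the gradient \<open>v\<close>
  is characterised state by state by \<open>\<nabla>\<^sup>2\<psi>(\<pi>\<^sub>s)(v\<^sub>s, w) = Q\<^sub>\<pi> s \<bullet> w\<close> for tangent \<open>w\<close>
  (\<open>policy_gradient_eq_flow_field\<close>). In other words, \<open>\<nabla>\<psi>(\<pi>\<^sub>s)\<close> moves with velocity \<open>Q\<^sub>\<pi> s\<close>, and the
  flow does not depend on the initial distribution, as long as all states are visited.

  Differentiating \<open>D(\<pi>, x t)\<close> along the flow for a fixed first argument \<open>\<pi>\<close> brings the weights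
  \<open>d\<^sub>\<pi>\<close> back, and the performance difference formula, now read with \<open>\<pi>\<close> as the new policy, gives
  \<open>R (x t) - R \<pi>\<close>. Hence \<open>D(\<pi>, x \<tau>) - D(x t, x \<tau>)\<close> is affine in \<open>\<tau>\<close> with slope \<open>R (x t) - R \<pi>\<close>, and
  comparing \<open>\<tau> = 0\<close> with \<open>\<tau> = t\<close> yields
    \<open>t * (R \<pi> - R (x t)) = D(\<pi>, x 0) - D(\<pi>, x t) - D(x t, x 0)\<close>
  (\<open>three_point_identity\<close>). Since \<open>D(\<pi>, x t)\<close> is nonnegative and vanishes only for \<open>\<pi> = x t\<close>, this is
  the central path property; it determines \<open>x t\<close>, so it also gives uniqueness of the flow, for which a
  vector field that is merely continuous would not suffice. Inserting an optimal \<open>\<pi>\<close> gives the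
  sublinear rate.

  Existence is obtained from the central path as well, instead of from a theorem on differential
  equations. The optimality conditions of the regularised problem, with the Bellman multipliers
  as extra unknowns, read \<open>dual_map z = dual_map \<pi>\<^sub>0 + t r\<close> for a map \<open>dual_map\<close> that is continuously
  differentiable and has an invertible derivative at \<open>\<pi>\<^sub>0\<close>; the inverse function theorem solves this for
  small \<open>t\<close>, and differentiating in \<open>t\<close> shows that the solution follows the flow
  (\<open>dual_deriv_reward\<close>, \<open>local_existence\<close>).

  For the limit, where \<open>\<psi>\<close> is continuous up to the boundary, let \<open>\<pi>*\<close> be a cluster point of the
  trajectory. The rate makes it optimal, and the identity makes it a minimiser of \<open>D(\<cdot>, x 0)\<close> over the optimal policies; moreover \<open>D(\<pi>, x t)\<close> tends to \<open>0\<close> along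
  the corresponding times for every minimiser \<open>\<pi>\<close>, which by strict convexity forces \<open>\<pi> = \<pi>*\<close> in all
  states that \<open>\<pi>*\<close> visits (\<open>cluster_point\<close>). States that the limit does not visit are handled by
  replacing the initial distribution by the uniform one, under which every policy visits every state
  and which leaves the flow unchanged (\<open>flow_converges\<close>).
\<close>

section \<open>Marginal laws of the trajectory\<close>

text \<open>The law of the state at time \<open>t\<close>, given by the Markov recursion. It replaces the law on infinite
trajectories, of which only the one-dimensional marginals enter rewards and occupancies.\<close>

primrec state_pmf ::
  "('s::finite \<Rightarrow> 'a::finite \<Rightarrow> 's pmf) \<Rightarrow> 's pmf \<Rightarrow> real ^ 'a ^ 's \<Rightarrow> nat \<Rightarrow> 's pmf"
where
  "state_pmf P \<mu> \<pi> 0 = \<mu>"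
| "state_pmf P \<mu> \<pi> (Suc t) =
     bind_pmf (bind_pmf (state_pmf P \<mu> \<pi> t) (act_pmf \<pi>)) (\<lambda>z. P (fst z) (snd z))"

definition state_action_pmf ::
  "('s::finite \<Rightarrow> 'a::finite \<Rightarrow> 's pmf) \<Rightarrow> 's pmf \<Rightarrow> real ^ 'a ^ 's \<Rightarrow> nat \<Rightarrow> ('s \<times> 'a) pmf"
where
  "state_action_pmf P \<mu> \<pi> t = bind_pmf (state_pmf P \<mu> \<pi> t) (act_pmf \<pi>)"

lemma measurable_trajectory_law_component:
  "(\<lambda>\<omega>. \<omega> t) \<in> measurable (trajectory_law P \<mu> \<pi>) (count_space UNIV)"
proof -
  interpret IT: Ionescu_Tulcea "step_kernel P \<mu> \<pi>" "\<lambda>_. count_space UNIV"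
    by (rule Ionescu_Tulcea_step_kernel)
  show ?thesis
    unfolding trajectory_law_def measurable_cong_sets[OF IT.PF.sets_lim refl]
    by (rule measurable_component_singleton) simp
qed

text \<open>The Ionescu-Tulcea construction specifies the law of the whole history up to \<open>t\<close> by successive kernels.
The kernel producing \<open>\<omega> (Suc k)\<close> looks at \<open>\<omega> k\<close> alone, so pushing the history law forward to its
last coordinate commutes with appending a step, and the marginals obey the Markov recursion.\<close>

lemma distr_trajectory_law:
  "distr (trajectory_law P \<mu> \<pi>) (count_space UNIV) (\<lambda>\<omega>. \<omega> t) = measure_pmf (state_action_pmf P \<mu> \<pi> t)"
proof -
  interpret IT: Ionescu_Tulcea "step_kernel P \<mu> \<pi>" "\<lambda>_. count_space UNIV"
    by (rule Ionescu_Tulcea_step_kernel)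
  let ?M = "\<lambda>J. PiM J (\<lambda>_. count_space UNIV) :: (nat \<Rightarrow> _) measure"
  let ?C = "\<lambda>t. IT.C 0 t (\<lambda>_. undefined)"
  have und: "(\<lambda>_. undefined) \<in> space (?M {0..<0})" by (simp add: space_PiM)
  have setsC: "sets (?C t) = sets (?M {0..<t})" for t using IT.sets_C[OF und, of t] by simp
  have spC: "space (?C t) = space (?M {0..<t})" for t using IT.space_C[OF und, of t] by simp
  have ne: "space (?C t) \<noteq> {}" for t
    using prob_space.not_empty[OF IT.prob_space_C[OF und, of t]] by simp
  have comp[measurable]: "(\<lambda>\<omega>. \<omega> t) \<in> measurable (?M {0..<Suc t}) (count_space UNIV)" for t
    by (rule measurable_component_singleton) simp
  \<comment> \<open>the last coordinate of the extended history is distributed according to the appended kernel\<close>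
  have distr_eP: "distr (IT.eP t \<omega>) (count_space UNIV) (\<lambda>\<omega>. \<omega> t) = step_kernel P \<mu> \<pi> t \<omega>"
    if \<omega>: "\<omega> \<in> space (?M {0..<t})" for t \<omega>
  proof -
    have 1: "fun_upd \<omega> t \<in> measurable (step_kernel P \<mu> \<pi> t \<omega>) (?M {0..<Suc t})"
      by (rule measurable_fun_upd[where J="{0..<t}"]) (use \<omega> IT.sets_P[OF \<omega>] in \<open>auto intro!: measurable_ident_sets\<close>)
    show ?thesis
      unfolding IT.eP_def
      by (subst distr_distr[OF comp 1]) (simp add: comp_def distr_id2 step_kernel_def)
  qed
  have step: "distr (?C (Suc t)) (count_space UNIV) (\<lambda>\<omega>. \<omega> t) = bind (?C t) (step_kernel P \<mu> \<pi> t)" for t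
  proof -
    have "distr (?C (Suc t)) (count_space UNIV) (\<lambda>\<omega>. \<omega> t)
        = bind (?C t) (\<lambda>\<omega>. distr (IT.eP t \<omega>) (count_space UNIV) (\<lambda>\<omega>. \<omega> t))"
      using ne[of t] IT.measurable_eP[of t]
      by (simp, subst distr_bind[where K="?M {0..<Suc t}"])
         (auto simp: setsC measurable_cong_sets[OF setsC refl] intro: comp)
    also have "\<dots> = bind (?C t) (step_kernel P \<mu> \<pi> t)"
      by (intro bind_cong refl) (auto simp: spC distr_eP)
    finally show ?thesis .
  qed
  have law: "distr (?C (Suc t)) (count_space UNIV) (\<lambda>\<omega>. \<omega> t) = measure_pmf (state_action_pmf P \<mu> \<pi> t)" for t
  proof (induction t)
    case 0
    have "bind (?C 0) (step_kernel P \<mu> \<pi> 0) = step_kernel P \<mu> \<pi> 0 (\<lambda>_. undefined)"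
      using bind_return[OF IT.P[of 0] und] by simp
    then show ?case unfolding step
      by (simp add: step_kernel_def state_action_pmf_def)
  next
    case (Suc k)
    let ?K = "\<lambda>z. measure_pmf (bind_pmf (P (fst z) (snd z)) (act_pmf \<pi>))"
    have "bind (?C (Suc k)) (step_kernel P \<mu> \<pi> (Suc k)) = bind (?C (Suc k)) (\<lambda>\<omega>. ?K (\<omega> k))"
      by (simp add: step_kernel_def[abs_def])
    also have "\<dots> = bind (distr (?C (Suc k)) (count_space UNIV) (\<lambda>\<omega>. \<omega> k)) ?K"
      by (subst bind_distr[where K="count_space UNIV"])
         (auto simp: measure_pmf_in_subprob_algebra measurable_cong_sets[OF setsC refl] ne
               simp del: IT.C.simps intro: comp)
    also have "\<dots> = bind (measure_pmf (state_action_pmf P \<mu> \<pi> k)) ?K" by (simp only: Suc)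
    also have "\<dots> = measure_pmf (state_action_pmf P \<mu> \<pi> (Suc k))"
      by (simp add: measure_pmf_bind[symmetric] state_action_pmf_def bind_assoc_pmf)
    finally show ?case unfolding step .
  qed
  \<comment> \<open>transfer from the histories of length \<open>Suc t\<close> to the law on infinite trajectories\<close>
  let ?J = "{0..<Suc t}"
  have up: "IT.up_to ?J = Suc t"
    by (rule antisym, subst IT.up_to_iff, simp, simp, rule Suc_leI, rule IT.up_to_less) auto
  have CI: "IT.CI ?J = ?C (Suc t)"
    unfolding IT.CI_def up
    by (rule trans[OF distr_cong distr_id2])
       (auto simp: spC setsC[symmetric] space_PiM PiE_iff restrict_def extensional_def fun_eq_iff simp del: IT.C.simps)
  have "distr IT.PF.lim (count_space UNIV) (\<lambda>\<omega>. \<omega> t)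
      = distr (distr IT.PF.lim (?M ?J) (\<lambda>\<omega>. restrict \<omega> ?J)) (count_space UNIV) (\<lambda>\<omega>. \<omega> t)"
    by (subst distr_distr[OF comp])
       (auto simp: measurable_cong_sets[OF IT.PF.sets_lim] comp_def intro!: measurable_restrict)
  also have "\<dots> = measure_pmf (state_action_pmf P \<mu> \<pi> t)"
    by (subst IT.distr_lim) (simp_all add: CI law del: IT.C.simps)
  finally show ?thesis unfolding trajectory_law_def .
qed

lemma pmf_act_pmf:
  assumes "\<pi> \<in> policies"
  shows "pmf (act_pmf \<pi> s) (s', a) = (if s' = s then \<pi> $ s $ a else 0)"
proof -
  have "pmf (embed_pmf (\<lambda>a. \<pi> $ s $ a)) a = \<pi> $ s $ a" for a
    using assms
    by (intro pmf_embed_pmf)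
       (auto simp: policies_def prob_simplex_def nn_integral_count_space_finite
          sum_ennreal simp flip: ennreal_1)
  then have *: "pmf (act_pmf \<pi> s) (s, a) = \<pi> $ s $ a"
    unfolding act_pmf_def by (subst pmf_map_inj') (auto simp: inj_on_def)
  show ?thesis
  proof (cases "s' = s")
    case False
    then have "(s', a) \<notin> set_pmf (act_pmf \<pi> s)" by (auto simp: act_pmf_def)
    then show ?thesis using False by (simp add: set_pmf_eq)
  qed (use * in simp)
qed

lemma map_fst_act_pmf: "map_pmf fst (act_pmf \<pi> s) = return_pmf s"
  by (simp add: act_pmf_def pmf.map_comp comp_def)

lemma map_fst_state_action_pmf: "map_pmf fst (state_action_pmf P \<mu> \<pi> t) = state_pmf P \<mu> \<pi> t"
  by (simp add: state_action_pmf_def map_bind_pmf map_fst_act_pmf bind_return_pmf')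

lemma pmf_state_action_pmf:
  assumes "\<pi> \<in> policies"
  shows "pmf (state_action_pmf P \<mu> \<pi> t) (s, a) = pmf (state_pmf P \<mu> \<pi> t) s * \<pi> $ s $ a"
proof -
  have "pmf (state_action_pmf P \<mu> \<pi> t) (s, a)
      = (\<Sum>s'\<in>UNIV. pmf (state_pmf P \<mu> \<pi> t) s' * (if s = s' then \<pi> $ s' $ a else 0))"
    unfolding state_action_pmf_def pmf_bind
    by (subst integral_measure_pmf_real[where A=UNIV]) (auto simp: pmf_act_pmf[OF assms] mult.commute)
  also have "\<dots> = (\<Sum>s'\<in>UNIV. if s = s' then pmf (state_pmf P \<mu> \<pi> t) s' * \<pi> $ s' $ a else 0)"
    by (intro sum.cong) auto
  finally show ?thesis by simp
qed

lemma sum_state_action: "(\<Sum>z\<in>(UNIV::('s::finite \<times> 'a::finite) set). f z) = (\<Sum>s\<in>UNIV. \<Sum>a\<in>UNIV. f (s, a))"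
  by (simp add: sum.cartesian_product flip: UNIV_Times_UNIV)

lemma pmf_state_pmf_Suc:
  assumes "\<pi> \<in> policies"
  shows "pmf (state_pmf P \<mu> \<pi> (Suc t)) s' =
    (\<Sum>s\<in>UNIV. pmf (state_pmf P \<mu> \<pi> t) s * (\<Sum>a\<in>UNIV. \<pi> $ s $ a * pmf (P s a) s'))"
proof -
  have "pmf (state_pmf P \<mu> \<pi> (Suc t)) s'
     = (\<Sum>z\<in>UNIV. pmf (P (fst z) (snd z)) s' * pmf (state_action_pmf P \<mu> \<pi> t) z)"
    unfolding state_pmf.simps state_action_pmf_def[symmetric] pmf_bind
    by (subst integral_measure_pmf_real[where A=UNIV]) auto
  then show ?thesis
    by (simp add: sum_state_action pmf_state_action_pmf[OF assms] sum_distrib_left mult_ac)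
qed

lemma state_occupancy_series:
  "state_occupancy P \<gamma> \<mu> \<pi> s = (1 - \<gamma>) * (\<Sum>t. \<gamma> ^ t * pmf (state_pmf P \<mu> \<pi> t) s)"
proof -
  have "measure (trajectory_law P \<mu> \<pi>) {\<omega> \<in> space (trajectory_law P \<mu> \<pi>). fst (\<omega> t) = s}
      = pmf (state_pmf P \<mu> \<pi> t) s" for t
  proof -
    let ?M = "trajectory_law P \<mu> \<pi>"
    have m: "(\<lambda>\<omega>. \<omega> t) \<in> measurable ?M (count_space UNIV)"
      by (rule measurable_trajectory_law_component)
    have "measure ?M {\<omega> \<in> space ?M. fst (\<omega> t) = s}
        = measure (distr ?M (count_space UNIV) (\<lambda>\<omega>. \<omega> t)) {z. fst z = s}"
      by (subst measure_distr[OF m]) (auto intro!: arg_cong[where f="measure ?M"])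
    also have "\<dots> = pmf (map_pmf fst (state_action_pmf P \<mu> \<pi> t)) s"
      by (simp add: distr_trajectory_law pmf_map vimage_def)
    finally show ?thesis by (simp add: map_fst_state_action_pmf)
  qed
  then show ?thesis by (simp add: state_occupancy_def)
qed


section \<open>Occupancies, value functions and the performance difference\<close>

text \<open>The initial distribution is not fixed in this locale: the convergence proof varies it.\<close>

locale discounted_mdp =
  fixes P :: "'s::finite \<Rightarrow> 'a::finite \<Rightarrow> 's pmf" and r :: "real ^ 'a ^ 's" and \<gamma> :: real
  assumes discount_nonneg: "0 \<le> \<gamma>" and discount_less_1: "\<gamma> < 1"
begin

definition next_mean :: "real ^ 's \<Rightarrow> 's \<Rightarrow> real ^ 'a" where
  "next_mean V s = (\<chi> a. \<Sum>s'\<in>UNIV. pmf (P s a) s' * V $ s')"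

abbreviation occ :: "'s pmf \<Rightarrow> real ^ 'a ^ 's \<Rightarrow> 's \<Rightarrow> real" where
  "occ \<mu> \<pi> \<equiv> state_occupancy P \<gamma> \<mu> \<pi>"

definition step_prob :: "real ^ 'a ^ 's \<Rightarrow> 's \<Rightarrow> 's \<Rightarrow> real" where
  "step_prob \<pi> s s' = (\<Sum>a\<in>UNIV. \<pi> $ s $ a * pmf (P s a) s')"

lemma sum_pmf_UNIV: "(\<Sum>x\<in>UNIV. pmf p (x::'x::finite)) = 1"
  by (simp add: sum_pmf_eq_1)

lemma policies_nonneg: "\<pi> \<in> policies \<Longrightarrow> 0 \<le> \<pi> $ s $ a"
  and policies_sum: "\<pi> \<in> policies \<Longrightarrow> (\<Sum>a\<in>UNIV. \<pi> $ s $ a) = 1"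
  by (auto simp: policies_def prob_simplex_def)

lemma step_prob_nonneg: "\<pi> \<in> policies \<Longrightarrow> 0 \<le> step_prob \<pi> s s'"
  unfolding step_prob_def by (intro sum_nonneg mult_nonneg_nonneg policies_nonneg) auto

lemma step_prob_sum:
  assumes "\<pi> \<in> policies" shows "(\<Sum>s'\<in>UNIV. step_prob \<pi> s s') = 1"
proof -
  have "(\<Sum>s'\<in>UNIV. step_prob \<pi> s s') = (\<Sum>a\<in>UNIV. \<pi> $ s $ a * (\<Sum>s'\<in>UNIV. pmf (P s a) s'))"
    unfolding step_prob_def sum_distrib_left by (rule sum.swap)
  then show ?thesis by (simp add: sum_pmf_UNIV policies_sum[OF assms])
qed

lemma inner_next_mean: "\<pi> $ s \<bullet> next_mean V s = (\<Sum>s'\<in>UNIV. step_prob \<pi> s s' * V $ s')"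
proof -
  have "\<pi> $ s \<bullet> next_mean V s = (\<Sum>a\<in>UNIV. \<Sum>s'\<in>UNIV. \<pi> $ s $ a * pmf (P s a) s' * V $ s')"
    by (simp add: inner_vec_def next_mean_def sum_distrib_left mult_ac)
  also have "\<dots> = (\<Sum>s'\<in>UNIV. step_prob \<pi> s s' * V $ s')"
    by (subst sum.swap) (simp add: step_prob_def sum_distrib_right)
  finally show ?thesis .
qed

lemma occ_summable: "summable (\<lambda>t. \<gamma> ^ t * pmf (state_pmf P \<mu> \<pi> t) s)"
  by (rule summable_comparison_test'[where g="\<lambda>t. \<gamma> ^ t" and N=0])
     (use discount_nonneg discount_less_1 in \<open>auto simp: pmf_le_1 mult_left_le intro!: summable_geometric\<close>)

lemma occ_nonneg: "0 \<le> occ \<mu> \<pi> s"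
  unfolding state_occupancy_series
  using discount_nonneg discount_less_1 by (intro mult_nonneg_nonneg suminf_nonneg occ_summable) auto

lemma occ_sum: "(\<Sum>s\<in>UNIV. occ \<mu> \<pi> s) = 1"
proof -
  have "(\<Sum>s\<in>UNIV. \<Sum>t. \<gamma> ^ t * pmf (state_pmf P \<mu> \<pi> t) s)
      = (\<Sum>t. \<Sum>s\<in>UNIV. \<gamma> ^ t * pmf (state_pmf P \<mu> \<pi> t) s)"
    by (rule suminf_sum[symmetric]) (rule occ_summable)
  also have "\<dots> = 1 / (1 - \<gamma>)"
    using discount_nonneg discount_less_1
    by (simp flip: sum_distrib_left add: sum_pmf_UNIV suminf_geometric)
  finally show ?thesis
    using discount_less_1 by (simp add: state_occupancy_series flip: sum_distrib_left)
qed

text \<open>Splitting off the term \<open>t = 0\<close> of the discounted series and shifting the rest by one step of the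
chain turns the series into a linear equation.\<close>

lemma occ_balance:
  assumes \<pi>: "\<pi> \<in> policies"
  shows "occ \<mu> \<pi> s' = (1 - \<gamma>) * pmf \<mu> s' + \<gamma> * (\<Sum>s\<in>UNIV. occ \<mu> \<pi> s * step_prob \<pi> s s')"
proof -
  let ?p = "\<lambda>t s. pmf (state_pmf P \<mu> \<pi> t) s"
  have "(\<Sum>t. \<gamma> ^ t * ?p t s') = pmf \<mu> s' + (\<Sum>t. \<gamma> ^ Suc t * ?p (Suc t) s')"
    using suminf_split_head[OF occ_summable[of \<mu> \<pi> s']] by simp
  also have "(\<Sum>t. \<gamma> ^ Suc t * ?p (Suc t) s')
      = (\<Sum>t. \<Sum>s\<in>UNIV. (\<gamma> * step_prob \<pi> s s') * (\<gamma> ^ t * ?p t s))"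
    unfolding pmf_state_pmf_Suc[OF \<pi>] step_prob_def[symmetric]
    by (simp add: sum_distrib_left mult_ac)
  also have "\<dots> = (\<Sum>s\<in>UNIV. \<Sum>t. (\<gamma> * step_prob \<pi> s s') * (\<gamma> ^ t * ?p t s))"
    by (rule suminf_sum) (intro summable_mult occ_summable)
  also have "\<dots> = (\<Sum>s\<in>UNIV. (\<gamma> * step_prob \<pi> s s') * (\<Sum>t. \<gamma> ^ t * ?p t s))"
    by (simp add: suminf_mult occ_summable)
  finally have "(\<Sum>t. \<gamma> ^ t * ?p t s')
     = pmf \<mu> s' + (\<Sum>s\<in>UNIV. (\<gamma> * step_prob \<pi> s s') * (\<Sum>t. \<gamma> ^ t * ?p t s))" .
  then show ?thesis
    unfolding state_occupancy_series
    by (simp add: algebra_simps sum_distrib_left)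
qed

text \<open>The reward is bounded and the weights are geometric, so the series can be integrated term by term, after
which only the marginal laws are involved.\<close>

lemma total_reward_occ:
  assumes \<pi>: "\<pi> \<in> policies"
  shows "total_reward P r \<gamma> \<mu> \<pi> = (\<Sum>s\<in>UNIV. occ \<mu> \<pi> s * (\<pi> $ s \<bullet> r $ s))"
proof -
  let ?M = "trajectory_law P \<mu> \<pi>"
  let ?p = "\<lambda>t s. pmf (state_pmf P \<mu> \<pi> t) s"
  let ?g = "\<lambda>z. r $ fst z $ snd z"
  interpret M: prob_space ?M by (rule prob_space_trajectory_law)
  note mc[measurable] = measurable_trajectory_law_component[of _ P \<mu> \<pi>]
  define B where "B = Max (range (\<lambda>z. \<bar>?g z\<bar>))"
  have B: "\<bar>?g z\<bar> \<le> B" for z unfolding B_def by (rule Max_ge) auto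
  have B0: "0 \<le> B" using B[of undefined] by linarith
  have meas: "(\<lambda>\<omega>. ?g (\<omega> t)) \<in> borel_measurable ?M" for t
    by (rule measurable_compose[OF mc]) simp
  have int: "integrable ?M (\<lambda>\<omega>. ?g (\<omega> t))" for t
    by (rule M.integrable_const_bound[where B=B]) (auto simp: B meas)
  have bound: "norm (\<gamma> ^ t * ?g z) \<le> B * \<gamma> ^ t" for t z
    using mult_right_mono[OF B[of z], of "\<gamma> ^ t"] discount_nonneg by (simp add: abs_mult mult.commute)
  have geo: "summable (\<lambda>t. B * \<gamma> ^ t)"
    using discount_nonneg discount_less_1 by (intro summable_mult summable_geometric) auto
  have mean: "(\<integral>\<omega>. ?g (\<omega> t) \<partial>?M) = (\<Sum>s\<in>UNIV. ?p t s * (\<pi> $ s \<bullet> r $ s))" for t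
  proof -
    have "(\<integral>\<omega>. ?g (\<omega> t) \<partial>?M) = (\<integral>z. ?g z \<partial>distr ?M (count_space UNIV) (\<lambda>\<omega>. \<omega> t))"
      by (rule integral_distr[symmetric]) (auto intro: mc)
    also have "\<dots> = (\<Sum>z\<in>UNIV. ?g z * pmf (state_action_pmf P \<mu> \<pi> t) z)"
      unfolding distr_trajectory_law by (subst integral_measure_pmf_real[where A=UNIV]) auto
    finally show ?thesis
      by (simp add: sum_state_action pmf_state_action_pmf[OF \<pi>] inner_vec_def sum_distrib_left mult_ac)
  qed
  have "(\<integral>\<omega>. (\<Sum>t. \<gamma> ^ t * ?g (\<omega> t)) \<partial>?M) = (\<Sum>t. \<integral>\<omega>. \<gamma> ^ t * ?g (\<omega> t) \<partial>?M)"
  proof (rule integral_suminf)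
    show "AE \<omega> in ?M. summable (\<lambda>t. norm (\<gamma> ^ t * ?g (\<omega> t)))"
      by (intro AE_I2 summable_comparison_test'[OF geo, where N=0]) (use bound in simp)
    show "summable (\<lambda>t. \<integral>\<omega>. norm (\<gamma> ^ t * ?g (\<omega> t)) \<partial>?M)"
    proof (rule summable_comparison_test'[OF geo, where N=0])
      fix t
      have "(\<integral>\<omega>. norm (\<gamma> ^ t * ?g (\<omega> t)) \<partial>?M) \<le> (\<integral>\<omega>. B * \<gamma> ^ t \<partial>?M)"
        using bound int[of t] by (intro integral_mono integrable_norm) auto
      then show "norm (\<integral>\<omega>. norm (\<gamma> ^ t * ?g (\<omega> t)) \<partial>?M) \<le> B * \<gamma> ^ t"
        by (simp add: M.prob_space)
    qed
  qed (use int in auto)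
  also have "\<dots> = (\<Sum>t. \<Sum>s\<in>UNIV. (\<pi> $ s \<bullet> r $ s) * (\<gamma> ^ t * ?p t s))"
    by (simp add: mean sum_distrib_left mult_ac)
  also have "\<dots> = (\<Sum>s\<in>UNIV. (\<pi> $ s \<bullet> r $ s) * (\<Sum>t. \<gamma> ^ t * ?p t s))"
    by (subst suminf_sum) (auto intro!: summable_mult occ_summable simp: suminf_mult occ_summable)
  finally show ?thesis
    unfolding total_reward_def state_occupancy_series by (simp add: sum_distrib_left mult_ac)
qed

text \<open>The adjoint of the transition operator is a contraction with factor \<open>\<gamma>\<close> in the \<open>\<ell>\<^sup>1\<close> norm. This single bound
gives uniqueness for the balance equation (\<open>b = 0\<close>) and its stability under perturbation of the policy.\<close>

lemma adjoint_estimate: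
  assumes \<pi>: "\<pi> \<in> policies"
    and x: "\<And>s'. x s' = b s' + \<gamma> * (\<Sum>s\<in>UNIV. x s * step_prob \<pi> s s')"
  shows "(1 - \<gamma>) * (\<Sum>s\<in>UNIV. \<bar>x s\<bar>) \<le> (\<Sum>s\<in>UNIV. \<bar>b s\<bar>)"
proof -
  have "\<bar>x s'\<bar> \<le> \<bar>b s'\<bar> + \<gamma> * (\<Sum>s\<in>UNIV. \<bar>x s\<bar> * step_prob \<pi> s s')" for s'
  proof -
    have "\<bar>x s'\<bar> \<le> \<bar>b s'\<bar> + \<bar>\<gamma> * (\<Sum>s\<in>UNIV. x s * step_prob \<pi> s s')\<bar>"
      by (subst x[of s']) (rule abs_triangle_ineq)
    also have "\<bar>\<gamma> * (\<Sum>s\<in>UNIV. x s * step_prob \<pi> s s')\<bar>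
        \<le> \<gamma> * (\<Sum>s\<in>UNIV. \<bar>x s\<bar> * step_prob \<pi> s s')"
      unfolding abs_mult
      using discount_nonneg step_prob_nonneg[OF \<pi>]
      by (auto intro!: mult_left_mono order_trans[OF sum_abs] sum_mono simp: abs_mult)
    finally show ?thesis by simp
  qed
  then have "(\<Sum>s'\<in>UNIV. \<bar>x s'\<bar>)
      \<le> (\<Sum>s'\<in>UNIV. \<bar>b s'\<bar> + \<gamma> * (\<Sum>s\<in>UNIV. \<bar>x s\<bar> * step_prob \<pi> s s'))"
    by (rule sum_mono)
  also have "\<dots> = (\<Sum>s'\<in>UNIV. \<bar>b s'\<bar>) + \<gamma> * (\<Sum>s'\<in>UNIV. \<Sum>s\<in>UNIV. \<bar>x s\<bar> * step_prob \<pi> s s')"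
    by (simp add: sum.distrib sum_distrib_left)
  also have "(\<Sum>s'\<in>UNIV. \<Sum>s\<in>UNIV. \<bar>x s\<bar> * step_prob \<pi> s s') = (\<Sum>s\<in>UNIV. \<bar>x s\<bar>)"
    by (subst sum.swap) (simp add: step_prob_sum[OF \<pi>] flip: sum_distrib_left)
  finally show ?thesis by (simp add: algebra_simps)
qed

text \<open>What a policy does in states it never reaches does not influence its occupancy: the difference of the two
occupancies solves the homogeneous balance equation. Note that only the states visited by \<open>\<pi>\<close> are compared.\<close>

lemma occ_cong_visited:
  assumes \<pi>: "\<pi> \<in> policies" and \<pi>': "\<pi>' \<in> policies"
    and eq: "\<And>s. 0 < occ \<mu> \<pi> s \<Longrightarrow> \<pi> $ s = \<pi>' $ s"
  shows "occ \<mu> \<pi> = occ \<mu> \<pi>'"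
proof -
  let ?x = "\<lambda>s. occ \<mu> \<pi> s - occ \<mu> \<pi>' s"
  have same: "occ \<mu> \<pi> s * step_prob \<pi> s s' = occ \<mu> \<pi> s * step_prob \<pi>' s s'" for s s'
    using eq[of s] occ_nonneg[of \<mu> \<pi> s] by (cases "occ \<mu> \<pi> s = 0") (auto simp: step_prob_def)
  have "?x s' = 0 + \<gamma> * (\<Sum>s\<in>UNIV. ?x s * step_prob \<pi>' s s')" for s'
    using occ_balance[OF \<pi>, of \<mu> s'] occ_balance[OF \<pi>', of \<mu> s']
    by (simp only: same left_diff_distrib right_diff_distrib sum_subtractf)
  from adjoint_estimate[OF \<pi>' this] have "(\<Sum>s\<in>UNIV. \<bar>?x s\<bar>) \<le> 0"
    using discount_less_1 by (simp add: mult_le_0_iff)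
  then have "(\<Sum>s\<in>UNIV. \<bar>?x s\<bar>) = 0" by (intro antisym sum_nonneg) auto
  then show ?thesis by (simp add: sum_nonneg_eq_0_iff fun_eq_iff)
qed

text \<open>The difference of two occupancies solves the balance equation of \<open>\<pi>'\<close> with the change of the transition
probabilities as source term.\<close>

lemma occ_lipschitz:
  assumes \<pi>: "\<pi> \<in> policies" and \<pi>': "\<pi>' \<in> policies"
  shows "(1 - \<gamma>) * (\<Sum>s\<in>UNIV. \<bar>occ \<mu> \<pi>' s - occ \<mu> \<pi> s\<bar>) \<le> real CARD('s) * real CARD('s) * real CARD('a) * norm (\<pi>' - \<pi>)"
proof -
  let ?x = "\<lambda>s. occ \<mu> \<pi>' s - occ \<mu> \<pi> s"
  let ?b = "\<lambda>s'. \<gamma> * (\<Sum>s\<in>UNIV. occ \<mu> \<pi> s * (step_prob \<pi>' s s' - step_prob \<pi> s s'))"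
  have "?x s' = ?b s' + \<gamma> * (\<Sum>s\<in>UNIV. ?x s * step_prob \<pi>' s s')" for s'
    using occ_balance[OF \<pi>, of \<mu> s'] occ_balance[OF \<pi>', of \<mu> s']
    by (simp add: algebra_simps sum_subtractf)
  from adjoint_estimate[OF \<pi>' this]
  have "(1 - \<gamma>) * (\<Sum>s\<in>UNIV. \<bar>?x s\<bar>) \<le> (\<Sum>s'\<in>UNIV. \<bar>?b s'\<bar>)" .
  also have "\<dots> \<le> (\<Sum>s'\<in>(UNIV::'s set). real CARD('s) * real CARD('a) * norm (\<pi>' - \<pi>))"
  proof (rule sum_mono)
    fix s'
    have step: "\<bar>step_prob \<pi>' s s' - step_prob \<pi> s s'\<bar> \<le> real CARD('a) * norm (\<pi>' - \<pi>)" for s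
    proof -
      have "\<bar>step_prob \<pi>' s s' - step_prob \<pi> s s'\<bar>
          = \<bar>\<Sum>a\<in>UNIV. (\<pi>' - \<pi>) $ s $ a * pmf (P s a) s'\<bar>"
        by (simp add: step_prob_def left_diff_distrib sum_subtractf)
      also have "\<dots> \<le> (\<Sum>a\<in>(UNIV::'a set). norm (\<pi>' - \<pi>))"
      proof (rule order_trans[OF sum_abs], rule sum_mono)
        fix a
        have "\<bar>(\<pi>' - \<pi>) $ s $ a\<bar> \<le> norm (\<pi>' - \<pi>)"
          by (rule order_trans[OF component_le_norm_cart Finite_Cartesian_Product.norm_nth_le])
        then show "\<bar>(\<pi>' - \<pi>) $ s $ a * pmf (P s a) s'\<bar> \<le> norm (\<pi>' - \<pi>)"
          unfolding abs_mult using pmf_le_1[of "P s a" s']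
          by (intro order_trans[OF mult_left_le]) auto
      qed
      finally show ?thesis by simp
    qed
    have occ1: "occ \<mu> \<pi> s \<le> 1" for s
      using member_le_sum[of s UNIV "occ \<mu> \<pi>"] occ_nonneg occ_sum[of \<mu> \<pi>] by auto
    have "\<bar>?b s'\<bar> \<le> \<bar>\<Sum>s\<in>UNIV. occ \<mu> \<pi> s * (step_prob \<pi>' s s' - step_prob \<pi> s s')\<bar>"
      using discount_nonneg discount_less_1 by (simp add: abs_mult mult_left_le_one_le)
    also have "\<dots> \<le> (\<Sum>s\<in>(UNIV::'s set). real CARD('a) * norm (\<pi>' - \<pi>))"
    proof (rule order_trans[OF sum_abs], rule sum_mono)
      fix s
      show "\<bar>occ \<mu> \<pi> s * (step_prob \<pi>' s s' - step_prob \<pi> s s')\<bar> \<le> real CARD('a) * norm (\<pi>' - \<pi>)"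
        unfolding abs_mult using occ1[of s] occ_nonneg[of \<mu> \<pi> s] step[of s]
        by (intro order_trans[OF mult_left_le_one_le]) auto
    qed
    finally show "\<bar>?b s'\<bar> \<le> real CARD('s) * real CARD('a) * norm (\<pi>' - \<pi>)" by simp
  qed
  finally show ?thesis by (simp add: mult_ac)
qed

text \<open>The transition operator itself is a contraction in the maximum norm.\<close>

lemma bellman_injective:
  assumes \<pi>: "\<pi> \<in> policies" and V: "\<And>s. V $ s = \<gamma> * (\<pi> $ s \<bullet> next_mean V s)"
  shows "V = 0"
proof -
  define m where "m = Max (range (\<lambda>s. \<bar>V $ s\<bar>))"
  have m: "\<bar>V $ s\<bar> \<le> m" for s unfolding m_def by (rule Max_ge) auto
  have "m \<in> range (\<lambda>s. \<bar>V $ s\<bar>)" unfolding m_def by (rule Max_in) auto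
  then obtain s where s: "m = \<bar>V $ s\<bar>" by auto
  have "m = \<gamma> * \<bar>\<Sum>s'\<in>UNIV. step_prob \<pi> s s' * V $ s'\<bar>"
    unfolding s by (subst V) (use discount_nonneg in \<open>simp add: inner_next_mean abs_mult\<close>)
  also have "\<dots> \<le> \<gamma> * (\<Sum>s'\<in>UNIV. step_prob \<pi> s s' * m)"
    using discount_nonneg m step_prob_nonneg[OF \<pi>]
    by (intro mult_left_mono order_trans[OF sum_abs] sum_mono) (auto simp: abs_mult intro: mult_left_mono)
  also have "\<dots> = \<gamma> * m" by (simp add: step_prob_sum[OF \<pi>] flip: sum_distrib_right)
  finally have "(1 - \<gamma>) * m \<le> 0" by (simp add: algebra_simps)
  then have "m \<le> 0" using discount_less_1 by (simp add: mult_le_0_iff)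
  then have "V $ s' = 0" for s' using m[of s'] by linarith
  then show ?thesis by (simp add: vec_eq_iff)
qed

lemma linear_next_mean: "linear (\<lambda>V. next_mean V s)"
  by (rule linearI) (simp_all add: next_mean_def vec_eq_iff algebra_simps sum.distrib sum_distrib_left)

lemma bellman_solvable:
  assumes \<pi>: "\<pi> \<in> policies"
  shows "\<exists>V. \<forall>s. V $ s = \<pi> $ s \<bullet> (r $ s + \<gamma> *\<^sub>R next_mean V s)"
proof -
  let ?T = "\<lambda>V. (\<chi> s. V $ s - \<gamma> * (\<pi> $ s \<bullet> next_mean V s)) :: real ^ 's"
  have lin: "linear ?T"
    by (rule linearI)
       (simp_all add: vec_eq_iff linear_add[OF linear_next_mean] linear_scale[OF linear_next_mean]
          inner_add_right algebra_simps)
  have "inj ?T"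
    unfolding linear_injective_0[OF lin]
  proof (intro allI impI)
    fix V assume "?T V = 0"
    then show "V = 0" by (intro bellman_injective[OF \<pi>]) (simp add: vec_eq_iff)
  qed
  then have "surj ?T" by (rule linear_inj_imp_surj[OF lin])
  from surjD[OF this, of "\<chi> s. \<pi> $ s \<bullet> r $ s"]
  obtain V where "?T V = (\<chi> s. \<pi> $ s \<bullet> r $ s)" by metis
  then show ?thesis
    by (intro exI[of _ V]) (auto simp: vec_eq_iff inner_add_right algebra_simps)
qed

definition value_fn :: "real ^ 'a ^ 's \<Rightarrow> real ^ 's" where
  "value_fn \<pi> = (SOME V. \<forall>s. V $ s = \<pi> $ s \<bullet> (r $ s + \<gamma> *\<^sub>R next_mean V s))"

definition q_fn :: "real ^ 'a ^ 's \<Rightarrow> 's \<Rightarrow> real ^ 'a" where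
  "q_fn \<pi> s = r $ s + \<gamma> *\<^sub>R next_mean (value_fn \<pi>) s"

lemma value_fn_eq:
  assumes "\<pi> \<in> policies" shows "value_fn \<pi> $ s = \<pi> $ s \<bullet> q_fn \<pi> s"
  using someI_ex[OF bellman_solvable[OF assms]] unfolding value_fn_def[symmetric] q_fn_def by blast

lemma value_fn_unique:
  assumes \<pi>: "\<pi> \<in> policies" and V: "\<And>s. V $ s = \<pi> $ s \<bullet> (r $ s + \<gamma> *\<^sub>R next_mean V s)"
  shows "V = value_fn \<pi>"
proof -
  have "V - value_fn \<pi> = 0"
  proof (rule bellman_injective[OF \<pi>])
    fix s
    show "(V - value_fn \<pi>) $ s = \<gamma> * (\<pi> $ s \<bullet> next_mean (V - value_fn \<pi>) s)"
      using V[of s] value_fn_eq[OF \<pi>, of s]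
      by (simp add: q_fn_def linear_diff[OF linear_next_mean] inner_add_right inner_diff_right algebra_simps)
  qed
  then show ?thesis by simp
qed

text \<open>By the Bellman equation, \<open>Q\<close> is the reward plus the discounted value of the next state; summing against the
occupancy of \<open>\<pi>'\<close> and using its balance equation, the values telescope up to the value of the initial
distribution, which is \<open>R \<pi>\<close>. Unlike a first-order expansion, the formula is exact and is
weighted by the occupancy of the new policy.\<close>

lemma performance_difference:
  assumes \<pi>: "\<pi> \<in> policies" and \<pi>': "\<pi>' \<in> policies"
  shows "total_reward P r \<gamma> \<mu> \<pi>' - total_reward P r \<gamma> \<mu> \<pi>
    = (\<Sum>s\<in>UNIV. occ \<mu> \<pi>' s * ((\<pi>' $ s - \<pi> $ s) \<bullet> q_fn \<pi> s))"
proof -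
  let ?V = "value_fn \<pi>"
  let ?v0 = "(1 - \<gamma>) * (\<Sum>s\<in>UNIV. pmf \<mu> s * ?V $ s)"
  have key: "(\<Sum>s\<in>UNIV. occ \<mu> \<pi>' s * (\<pi>' $ s \<bullet> q_fn \<pi> s)) - (\<Sum>s\<in>UNIV. occ \<mu> \<pi>' s * ?V $ s)
      = total_reward P r \<gamma> \<mu> \<pi>' - ?v0" if \<pi>': "\<pi>' \<in> policies" for \<pi>'
  proof -
    have "(\<Sum>s\<in>UNIV. occ \<mu> \<pi>' s * (\<pi>' $ s \<bullet> q_fn \<pi> s))
        = total_reward P r \<gamma> \<mu> \<pi>'
          + (\<Sum>s\<in>UNIV. \<Sum>s'\<in>UNIV. \<gamma> * (occ \<mu> \<pi>' s * step_prob \<pi>' s s') * ?V $ s')"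
      unfolding total_reward_occ[OF \<pi>'] q_fn_def
      by (simp add: inner_add_right inner_next_mean distrib_left sum.distrib sum_distrib_left mult_ac)
    also have "(\<Sum>s\<in>UNIV. \<Sum>s'\<in>UNIV. \<gamma> * (occ \<mu> \<pi>' s * step_prob \<pi>' s s') * ?V $ s')
        = (\<Sum>s'\<in>UNIV. \<gamma> * (\<Sum>s\<in>UNIV. occ \<mu> \<pi>' s * step_prob \<pi>' s s') * ?V $ s')"
      by (subst sum.swap) (simp add: sum_distrib_left sum_distrib_right)
    also have "\<dots> = (\<Sum>s'\<in>UNIV. (occ \<mu> \<pi>' s' - (1 - \<gamma>) * pmf \<mu> s') * ?V $ s')"
    proof (intro sum.cong refl arg_cong2[where f="(*)"])
      fix s'
      show "\<gamma> * (\<Sum>s\<in>UNIV. occ \<mu> \<pi>' s * step_prob \<pi>' s s') = occ \<mu> \<pi>' s' - (1 - \<gamma>) * pmf \<mu> s'"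
        using occ_balance[OF \<pi>', of \<mu> s'] by linarith
    qed
    also have "\<dots> = (\<Sum>s'\<in>UNIV. occ \<mu> \<pi>' s' * ?V $ s') - ?v0"
      by (simp only: left_diff_distrib sum_subtractf sum_distrib_left mult.assoc)
    finally show ?thesis by simp
  qed
  have "total_reward P r \<gamma> \<mu> \<pi> = ?v0"
    using key[OF \<pi>] by (simp flip: value_fn_eq[OF \<pi>])
  then show ?thesis
    using key[OF \<pi>']
    by (simp add: inner_diff_left value_fn_eq[OF \<pi>] right_diff_distrib sum_subtractf)
qed

end


section \<open>Compactness and tangent directions of the policy polytope\<close>

lemma int_policies_subset: "int_policies \<subseteq> policies"
  by (auto simp: int_policies_def policies_def int_simplex_def prob_simplex_def intro: less_imp_le)

lemma int_simplex_subset: "int_simplex \<subseteq> prob_simplex"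
  by (auto simp: int_simplex_def prob_simplex_def intro: less_imp_le)

lemma compact_policies: "compact (policies :: (real ^ 'a::finite ^ 's::finite) set)"
proof -
  have "(policies :: (real ^ 'a ^ 's) set)
      = (\<Inter>s. \<Inter>a. {\<pi>. 0 \<le> \<pi> $ s $ a}) \<inter> (\<Inter>s. {\<pi>. (\<Sum>a\<in>UNIV. \<pi> $ s $ a) = 1})"
    by (auto simp: policies_def prob_simplex_def)
  also have "closed \<dots>"
    by (intro closed_Int closed_INT ballI closed_Collect_le closed_Collect_eq continuous_intros)
  finally have "closed (policies :: (real ^ 'a ^ 's) set)" .
  moreover have "bounded (policies :: (real ^ 'a ^ 's) set)"
  proof (rule boundedI)
    fix \<pi> :: "real ^ 'a ^ 's" assume \<pi>: "\<pi> \<in> policies"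
    have "norm (\<pi> $ s) \<le> 1" for s
    proof -
      have "norm (\<pi> $ s) \<le> (\<Sum>a\<in>UNIV. \<bar>\<pi> $ s $ a\<bar>)" by (rule norm_le_l1_cart)
      also have "\<dots> = 1" using \<pi> by (simp add: policies_def prob_simplex_def)
      finally show ?thesis .
    qed
    then have "norm \<pi> \<le> (\<Sum>s\<in>(UNIV::'s set). 1)"
      unfolding norm_vec_def[of \<pi>] by (intro order_trans[OF L2_set_le_sum] sum_mono) auto
    then show "norm \<pi> \<le> real CARD('s)" by simp
  qed
  ultimately show ?thesis by (simp add: compact_eq_bounded_closed)
qed

lemma int_policies_direction:
  fixes \<pi> :: "real ^ 'a::finite ^ 's::finite"
  assumes "\<pi> \<in> int_policies" "w \<in> tangent_policies"
  shows "\<exists>d>0. \<forall>e. \<bar>e\<bar> < d \<longrightarrow> \<pi> + e *\<^sub>R w \<in> int_policies"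
proof -
  have "eventually (\<lambda>e. 0 < \<pi> $ s $ a + e * w $ s $ a) (nhds (0::real))" for s a
  proof (rule order_tendstoD)
    have "((\<lambda>e. \<pi> $ s $ a + e * w $ s $ a) \<longlongrightarrow> \<pi> $ s $ a + 0 * w $ s $ a) (nhds (0::real))"
      by (intro tendsto_intros filterlim_ident)
    then show "((\<lambda>e. \<pi> $ s $ a + e * w $ s $ a) \<longlongrightarrow> \<pi> $ s $ a) (nhds (0::real))" by simp
    show "0 < \<pi> $ s $ a" using assms by (auto simp: int_policies_def int_simplex_def)
  qed
  then have "eventually (\<lambda>e. \<forall>s a. 0 < \<pi> $ s $ a + e * w $ s $ a) (nhds (0::real))"
    by (intro eventually_all_finite)
  then obtain d where d: "d > 0" "\<And>e s a. \<bar>e\<bar> < d \<Longrightarrow> 0 < \<pi> $ s $ a + e * w $ s $ a"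
    unfolding eventually_nhds_metric by (auto simp: dist_real_def)
  have "(\<Sum>a\<in>UNIV. \<pi> $ s $ a + e * w $ s $ a) = 1" for e s
    using assms
    by (simp add: int_policies_def int_simplex_def tangent_policies_def tangent_simplex_def
        sum.distrib flip: sum_distrib_left)
  with d show ?thesis by (intro exI[of _ d]) (simp add: int_policies_def int_simplex_def)
qed

lemma int_simplex_direction:
  fixes p :: "real ^ 'a::finite"
  assumes "p \<in> int_simplex" "v \<in> tangent_simplex"
  shows "\<exists>d>0. \<forall>e. \<bar>e\<bar> < d \<longrightarrow> p + e *\<^sub>R v \<in> int_simplex"
  using int_policies_direction[of "\<chi> _::unit. p" "\<chi> _. v"] assms
  by (simp add: int_policies_def tangent_policies_def)

lemma has_derivative_vecI:
  fixes f :: "'v::real_normed_vector \<Rightarrow> 'w::euclidean_space ^ 'n::finite"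
  assumes "\<And>i. ((\<lambda>x. f x $ i) has_derivative (\<lambda>h. f' h $ i)) (at x within S)"
  shows "(f has_derivative f') (at x within S)"
  unfolding has_derivative_componentwise_within[of f]
  by (auto simp: Basis_vec_def inner_axis intro: has_derivative_inner_left assms)

text \<open>Within a set of empty interior, such as the simplex, a derivative is not unique as a linear map, but it is
determined along every direction in which a segment around the point stays in the set.\<close>

lemma has_derivative_unique_direction:
  fixes f :: "'v::real_normed_vector \<Rightarrow> 'w::real_normed_vector"
  assumes A: "(f has_derivative A) (at x within S)" and B: "(f has_derivative B) (at x within S)"
    and d: "\<exists>d>0. \<forall>e. \<bar>e\<bar> < d \<longrightarrow> x + e *\<^sub>R v \<in> S"
  shows "A v = B v"
proof -
  obtain d where d: "d > 0" "\<And>e. \<bar>e\<bar> < d \<Longrightarrow> x + e *\<^sub>R v \<in> S" using d by blast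
  let ?l = "\<lambda>e::real. x + e *\<^sub>R v" and ?I = "{-d<..<d}"
  have l: "(?l has_derivative (\<lambda>e. e *\<^sub>R v)) (at 0 within ?I)"
    by (auto intro!: derivative_eq_intros)
  have sub: "?l ` ?I \<subseteq> S" using d by auto
  have along: "((\<lambda>e. f (?l e)) has_derivative (\<lambda>e. F (e *\<^sub>R v))) (at 0)"
    if "(f has_derivative F) (at x within S)" for F
  proof -
    have "((\<lambda>e. f (?l e)) has_derivative (\<lambda>e. F (e *\<^sub>R v))) (at 0 within ?I)"
      by (rule has_derivative_in_compose[OF l]) (use has_derivative_subset[OF that sub] in simp)
    then show ?thesis using d by (simp add: at_within_open[of 0 ?I])
  qed
  from has_derivative_unique[OF along[OF A] along[OF B]] have "A (1 *\<^sub>R v) = B (1 *\<^sub>R v)"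
    by (rule fun_cong)
  then show ?thesis by simp
qed

section \<open>Regularity of the reward\<close>

context discounted_mdp
begin

lemma occ_dist:
  assumes \<pi>: "\<pi> \<in> policies" and \<pi>': "\<pi>' \<in> policies"
  shows "\<bar>occ \<mu> \<pi>' s - occ \<mu> \<pi> s\<bar>
    \<le> real CARD('s) * real CARD('s) * real CARD('a) / (1 - \<gamma>) * norm (\<pi>' - \<pi>)"
proof -
  have "\<bar>occ \<mu> \<pi>' s - occ \<mu> \<pi> s\<bar> \<le> (\<Sum>s\<in>UNIV. \<bar>occ \<mu> \<pi>' s - occ \<mu> \<pi> s\<bar>)"
    by (rule member_le_sum) auto
  also have "\<dots> \<le> real CARD('s) * real CARD('s) * real CARD('a) / (1 - \<gamma>) * norm (\<pi>' - \<pi>)"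
    using occ_lipschitz[OF \<pi> \<pi>', of \<mu>] discount_less_1 by (simp add: field_simps)
  finally show ?thesis .
qed

lemma continuous_on_occ: "continuous_on policies (\<lambda>\<pi>. occ \<mu> \<pi> s)"
proof (rule lipschitz_on_continuous_on)
  show "(real CARD('s) * real CARD('s) * real CARD('a) / (1 - \<gamma>))-lipschitz_on policies (\<lambda>\<pi>. occ \<mu> \<pi> s)"
    using discount_less_1 by (intro lipschitz_onI) (use occ_dist in \<open>auto simp: dist_norm\<close>)
qed

lemma continuous_on_total_reward: "continuous_on policies (total_reward P r \<gamma> \<mu>)"
proof (rule continuous_on_eq)
  show "continuous_on policies (\<lambda>\<pi>. \<Sum>s\<in>UNIV. occ \<mu> \<pi> s * (\<pi> $ s \<bullet> r $ s))"
    by (intro continuous_intros continuous_on_occ)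
qed (simp add: total_reward_occ)

lemma opt_policies_nonempty: "opt_policies P r \<gamma> \<mu> \<noteq> {}"
  and total_reward_le_opt: "\<pi> \<in> policies \<Longrightarrow> total_reward P r \<gamma> \<mu> \<pi> \<le> opt_reward P r \<gamma> \<mu>"
proof -
  have "(\<chi> s a. 1 / real CARD('a)) \<in> (policies :: (real ^ 'a ^ 's) set)"
    by (simp add: policies_def prob_simplex_def)
  then have "(policies :: (real ^ 'a ^ 's) set) \<noteq> {}" by blast
  from continuous_attains_sup[OF compact_policies this continuous_on_total_reward]
  obtain \<pi>m where \<pi>m: "\<pi>m \<in> policies"
    "\<And>\<pi>. \<pi> \<in> policies \<Longrightarrow> total_reward P r \<gamma> \<mu> \<pi> \<le> total_reward P r \<gamma> \<mu> \<pi>m"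
    by blast
  then have "opt_reward P r \<gamma> \<mu> = total_reward P r \<gamma> \<mu> \<pi>m"
    unfolding opt_reward_def by (intro cSup_eq_maximum) auto
  with \<pi>m show "opt_policies P r \<gamma> \<mu> \<noteq> {}"
    "\<pi> \<in> policies \<Longrightarrow> total_reward P r \<gamma> \<mu> \<pi> \<le> opt_reward P r \<gamma> \<mu>"
    by (auto simp: opt_policies_def)
qed

text \<open>Policy gradient theorem. Replacing the occupancy of the new policy by that of \<open>\<pi>\<close> in the performance
difference formula costs a product of two first-order terms.\<close>

lemma total_reward_has_derivative:
  assumes \<pi>: "\<pi> \<in> policies"
  shows "(total_reward P r \<gamma> \<mu> has_derivative (\<lambda>w. \<Sum>s\<in>UNIV. occ \<mu> \<pi> s * (w $ s \<bullet> q_fn \<pi> s)))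
    (at \<pi> within policies)"
proof -
  define L where "L = real CARD('s) * real CARD('s) * real CARD('a) / (1 - \<gamma>)"
  define K where "K = (\<Sum>s\<in>UNIV. L * norm (q_fn \<pi> s))"
  let ?F = "\<lambda>w. \<Sum>s\<in>UNIV. occ \<mu> \<pi> s * (w $ s \<bullet> q_fn \<pi> s)"
  have L0: "0 \<le> L" unfolding L_def using discount_less_1 by simp
  have bl: "bounded_linear ?F"
    by (intro bounded_linear_sum bounded_linear_mult_right[THEN bounded_linear_compose]
        bounded_linear_inner_left[THEN bounded_linear_compose] bounded_linear_vec_nth)
  show ?thesis
  proof (rule has_derivativeI_sandwich[OF zero_less_one bl, where H="\<lambda>\<pi>'. K * norm (\<pi>' - \<pi>)"])
    fix \<pi>' assume \<pi>': "\<pi>' \<in> policies" and ne: "\<pi>' \<noteq> \<pi>"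
    have "(total_reward P r \<gamma> \<mu> \<pi>' - total_reward P r \<gamma> \<mu> \<pi>) - ?F (\<pi>' - \<pi>)
        = (\<Sum>s\<in>UNIV. (occ \<mu> \<pi>' s - occ \<mu> \<pi> s) * ((\<pi>' - \<pi>) $ s \<bullet> q_fn \<pi> s))"
      by (simp add: performance_difference[OF \<pi> \<pi>'] left_diff_distrib sum_subtractf)
    also have "\<bar>\<dots>\<bar> \<le> (\<Sum>s\<in>UNIV. (L * norm (\<pi>' - \<pi>)) * (norm (\<pi>' - \<pi>) * norm (q_fn \<pi> s)))"
    proof (rule order_trans[OF sum_abs], rule sum_mono)
      fix s
      have "\<bar>(\<pi>' - \<pi>) $ s \<bullet> q_fn \<pi> s\<bar> \<le> norm ((\<pi>' - \<pi>) $ s) * norm (q_fn \<pi> s)"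
        by (rule Cauchy_Schwarz_ineq2)
      also have "\<dots> \<le> norm (\<pi>' - \<pi>) * norm (q_fn \<pi> s)"
        by (intro mult_right_mono Finite_Cartesian_Product.norm_nth_le) auto
      finally show "\<bar>(occ \<mu> \<pi>' s - occ \<mu> \<pi> s) * ((\<pi>' - \<pi>) $ s \<bullet> q_fn \<pi> s)\<bar>
          \<le> (L * norm (\<pi>' - \<pi>)) * (norm (\<pi>' - \<pi>) * norm (q_fn \<pi> s))"
        unfolding abs_mult using occ_dist[OF \<pi> \<pi>', of \<mu> s] L0
        by (intro mult_mono) (auto simp: L_def)
    qed
    also have "\<dots> = K * norm (\<pi>' - \<pi>) * norm (\<pi>' - \<pi>)"
      by (simp add: K_def sum_distrib_left sum_distrib_right mult_ac)
    finally show "norm ((total_reward P r \<gamma> \<mu> \<pi>' - total_reward P r \<gamma> \<mu> \<pi>) - ?F (\<pi>' - \<pi>)) / norm (\<pi>' - \<pi>)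
        \<le> K * norm (\<pi>' - \<pi>)"
      using ne by (simp add: divide_le_eq)
  next
    have "((\<lambda>\<pi>'. K * norm (\<pi>' - \<pi>)) \<longlongrightarrow> K * norm (\<pi> - \<pi>)) (at \<pi> within policies)"
      by (intro tendsto_intros)
    then show "((\<lambda>\<pi>'. K * norm (\<pi>' - \<pi>)) \<longlongrightarrow> 0) (at \<pi> within policies)" by simp
  qed
qed

lemma total_reward_frechet_derivative:
  assumes \<pi>: "\<pi> \<in> int_policies" and w: "w \<in> tangent_policies"
  shows "frechet_derivative (total_reward P r \<gamma> \<mu>) (at \<pi> within int_policies) w
    = (\<Sum>s\<in>UNIV. occ \<mu> \<pi> s * (w $ s \<bullet> q_fn \<pi> s))"
proof -
  have D: "(total_reward P r \<gamma> \<mu> has_derivative (\<lambda>w. \<Sum>s\<in>UNIV. occ \<mu> \<pi> s * (w $ s \<bullet> q_fn \<pi> s)))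
      (at \<pi> within int_policies)"
    using total_reward_has_derivative[of \<pi> \<mu>] \<pi> int_policies_subset
    by (auto intro: has_derivative_subset)
  then have "(total_reward P r \<gamma> \<mu> has_derivative
      frechet_derivative (total_reward P r \<gamma> \<mu>) (at \<pi> within int_policies)) (at \<pi> within int_policies)"
    using frechet_derivative_works differentiable_def by blast
  then show ?thesis
    using has_derivative_unique_direction[OF _ D int_policies_direction[OF \<pi> w]] by blast
qed

end

section \<open>The potential along the simplex\<close>

text \<open>Orthogonal projection onto the tangent space of the simplex, and below it the projection onto its affine hull.
Composing with the latter turns derivatives within \<open>int_simplex\<close> into derivatives on an open set, where
the chain rule and the inverse function theorem apply.\<close>

definition center :: "real ^ 'a::finite \<Rightarrow> real ^ 'a" where
  "center v = v - ((v \<bullet> 1) / real CARD('a)) *\<^sub>R 1"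

definition affine_proj :: "real ^ 'a::finite \<Rightarrow> real ^ 'a" where
  "affine_proj x = x + ((1 - x \<bullet> 1) / real CARD('a)) *\<^sub>R 1"

lemma inner_1: "(v::real ^ 'a::finite) \<bullet> 1 = (\<Sum>a\<in>UNIV. v $ a)"
  by (simp add: inner_vec_def)

lemma inner_1_1: "(1::real ^ 'a::finite) \<bullet> 1 = real CARD('a)"
  by (simp add: inner_1)

lemma tangent_simplex_iff: "v \<in> tangent_simplex \<longleftrightarrow> v \<bullet> 1 = 0"
  by (simp add: tangent_simplex_def inner_1)

lemma int_simplex_sum: "p \<in> int_simplex \<Longrightarrow> p \<bullet> 1 = 1"
  and prob_simplex_sum: "p \<in> prob_simplex \<Longrightarrow> p \<bullet> 1 = 1"
  by (simp_all add: int_simplex_def prob_simplex_def inner_1)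

lemma linear_center: "linear center"
  by (rule linearI) (simp_all add: center_def vec_eq_iff inner_add_left add_divide_distrib right_diff_distrib)

lemma center_tangent: "center v \<in> tangent_simplex"
  by (simp add: tangent_simplex_iff center_def inner_diff_left inner_1_1)

lemma center_id: "v \<in> tangent_simplex \<Longrightarrow> center v = v"
  by (simp add: tangent_simplex_iff center_def)

lemma center_1: "center 1 = 0"
  by (simp add: center_def inner_1_1)

lemma affine_proj_id: "p \<bullet> 1 = 1 \<Longrightarrow> affine_proj p = p"
  by (simp add: affine_proj_def)

lemma affine_proj_sum: "affine_proj x \<bullet> 1 = 1"
  by (simp add: affine_proj_def inner_add_left inner_1_1)

lemma affine_proj_has_derivative:
  "((affine_proj :: real ^ 'a::finite \<Rightarrow> _) has_derivative center) (at x within S)"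
proof -
  have "affine_proj = (\<lambda>x::real ^ 'a. center x + (1 / real CARD('a)) *\<^sub>R 1)"
    by (simp add: affine_proj_def center_def fun_eq_iff diff_divide_distrib scaleR_diff_left)
  then show ?thesis
    using has_derivative_add_const[OF linear_imp_has_derivative[OF linear_center]] by metis
qed

lemma continuous_on_affine_proj: "continuous_on S affine_proj"
  by (rule has_derivative_continuous_on[where f'="\<lambda>_. center"]) (rule affine_proj_has_derivative)

lemma center_expand: "center v = (\<Sum>a\<in>UNIV. v $ a *\<^sub>R center (axis a 1))"
proof -
  have "v = (\<Sum>a\<in>UNIV. v $ a *\<^sub>R axis a 1)"
    using basis_expansion[of v] by (simp add: scalar_mult_eq_scaleR)
  then have "center v = center (\<Sum>a\<in>UNIV. v $ a *\<^sub>R axis a 1)" by (rule arg_cong)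
  then show ?thesis by (simp add: linear_sum[OF linear_center] linear_scale[OF linear_center])
qed

lemma open_affine_proj_int: "open {x. affine_proj x \<in> int_simplex}"
proof -
  have "{x. affine_proj x \<in> int_simplex} = (\<Inter>a. {x::real ^ 'a. 0 < affine_proj x $ a})"
    using affine_proj_sum by (auto simp: int_simplex_def inner_1)
  also have "open \<dots>"
    by (intro open_INT ballI open_Collect_less continuous_intros continuous_on_affine_proj) auto
  finally show ?thesis .
qed

locale potential =
  fixes \<psi> :: "real ^ 'a::finite \<Rightarrow> real"
  assumes strict_conv: "strictly_convex_on prob_simplex \<psi>"
    and C2: "C2_on_int_simplex \<psi>"
    and hess_pos: "\<forall>p\<in>int_simplex. \<forall>v\<in>tangent_simplex. v \<noteq> 0 \<longrightarrow> 0 < simplex_hess \<psi> p v v"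
begin

text \<open>The representatives of the first and second derivative along the simplex that are orthogonal to the constant
vector; a derivative within \<open>int_simplex\<close> is meaningful on tangent vectors only, hence the centered basis.\<close>

definition grad :: "real ^ 'a \<Rightarrow> real ^ 'a" where
  "grad p = (\<chi> a. simplex_deriv \<psi> p (center (axis a 1)))"

definition hess_vec :: "real ^ 'a \<Rightarrow> real ^ 'a \<Rightarrow> real ^ 'a" where
  "hess_vec p u = (\<chi> a. simplex_hess \<psi> p (center u) (center (axis a 1)))"

lemma psi_deriv:
  "p \<in> int_simplex \<Longrightarrow> (\<psi> has_derivative simplex_deriv \<psi> p) (at p within int_simplex)"
  using C2 frechet_derivative_works
  unfolding C2_on_int_simplex_def differentiable_on_def simplex_deriv_def[abs_def] by blast

lemma simplex_deriv_deriv: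
  "p \<in> int_simplex \<Longrightarrow> v \<in> tangent_simplex \<Longrightarrow>
    ((\<lambda>q. simplex_deriv \<psi> q v) has_derivative (\<lambda>u. simplex_hess \<psi> p u v)) (at p within int_simplex)"
  using C2 frechet_derivative_works
  unfolding C2_on_int_simplex_def differentiable_on_def simplex_hess_def[abs_def] by blast

lemma simplex_deriv_center:
  assumes "p \<in> int_simplex" shows "simplex_deriv \<psi> p (center v) = grad p \<bullet> v"
proof -
  have "linear (simplex_deriv \<psi> p)" using psi_deriv[OF assms] by (rule has_derivative_linear)
  then show ?thesis
    by (subst center_expand) (simp add: linear_sum linear_scale grad_def inner_vec_def mult.commute)
qed

lemma simplex_deriv_tangent:
  "p \<in> int_simplex \<Longrightarrow> v \<in> tangent_simplex \<Longrightarrow> simplex_deriv \<psi> p v = grad p \<bullet> v"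
  using simplex_deriv_center[of p v] by (simp add: center_id)

lemma grad_inner_1: "p \<in> int_simplex \<Longrightarrow> grad p \<bullet> 1 = 0"
  using simplex_deriv_center[of p 1] simplex_deriv_center[of p 0]
  by (simp add: center_1 linear_0[OF linear_center])

lemma grad_inner_center:
  "p \<in> int_simplex \<Longrightarrow> grad p \<bullet> center v = grad p \<bullet> v"
  by (simp add: center_def inner_diff_right grad_inner_1)

text \<open>The Hessian is defined by differentiating once per fixed second argument, so its linearity in that argument is
not built in. It follows from linearity of the first derivative because derivatives
along tangent directions are unique.\<close>

lemma hess_vec_inner:
  assumes p: "p \<in> int_simplex"
  shows "hess_vec p u \<bullet> v = simplex_hess \<psi> p (center u) (center v)"
proof -
  have 1: "((\<lambda>q. \<Sum>a\<in>UNIV. v $ a * simplex_deriv \<psi> q (center (axis a 1))) has_derivative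
      (\<lambda>u. \<Sum>a\<in>UNIV. v $ a * simplex_hess \<psi> p u (center (axis a 1)))) (at p within int_simplex)"
    by (intro has_derivative_sum has_derivative_mult_right simplex_deriv_deriv p center_tangent)
  have 2: "((\<lambda>q. \<Sum>a\<in>UNIV. v $ a * simplex_deriv \<psi> q (center (axis a 1))) has_derivative
      (\<lambda>u. simplex_hess \<psi> p u (center v))) (at p within int_simplex)"
  proof (rule has_derivative_transform[OF p _ simplex_deriv_deriv[OF p center_tangent]])
    fix q :: "real ^ 'a" assume "q \<in> int_simplex"
    from simplex_deriv_center[OF this, of v]
    show "(\<Sum>a\<in>UNIV. v $ a * simplex_deriv \<psi> q (center (axis a 1))) = simplex_deriv \<psi> q (center v)"
      by (simp add: grad_def inner_vec_def mult.commute)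
  qed
  from has_derivative_unique_direction[OF 1 2 int_simplex_direction[OF p center_tangent[of u]]]
  show ?thesis by (simp add: hess_vec_def inner_vec_def mult.commute)
qed

lemma linear_hess_vec:
  assumes p: "p \<in> int_simplex" shows "linear (hess_vec p)"
proof -
  have "linear (\<lambda>u. simplex_hess \<psi> p u (center (axis a 1)))" for a
    by (rule has_derivative_linear[OF simplex_deriv_deriv[OF p center_tangent]])
  from linear_compose[OF linear_center this] show ?thesis
    unfolding hess_vec_def linear_iff by (simp add: vec_eq_iff comp_def)
qed

lemma hess_vec_nonneg: "p \<in> int_simplex \<Longrightarrow> 0 \<le> hess_vec p u \<bullet> u"
  and hess_vec_definite: "p \<in> int_simplex \<Longrightarrow> hess_vec p u \<bullet> u = 0 \<Longrightarrow> center u = 0"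
proof -
  assume p: "p \<in> int_simplex"
  have pos: "0 < hess_vec p u \<bullet> u" if "center u \<noteq> 0"
    using hess_pos p that center_tangent[of u] by (simp add: hess_vec_inner)
  moreover have "hess_vec p u \<bullet> u = 0" if "center u = 0"
    using that p linear_0[OF has_derivative_linear[OF simplex_deriv_deriv[OF p center_tangent[of u]]]]
    by (simp add: hess_vec_inner)
  ultimately show "0 \<le> hess_vec p u \<bullet> u" by fastforce
  show "hess_vec p u \<bullet> u = 0 \<Longrightarrow> center u = 0" using pos by fastforce
qed

lemma affine_chain:
  assumes g: "(g has_derivative G) (at (affine_proj x) within int_simplex)"
    and x: "affine_proj x \<in> int_simplex"
  shows "((\<lambda>x. g (affine_proj x)) has_derivative (\<lambda>u. G (center u))) (at x)"
proof -
  let ?W = "{x. affine_proj x \<in> int_simplex}"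
  have "((\<lambda>x. g (affine_proj x)) has_derivative (\<lambda>u. G (center u))) (at x within ?W)"
    by (rule has_derivative_in_compose[OF affine_proj_has_derivative has_derivative_subset[OF g]]) auto
  moreover have "at x within ?W = at x"
    using x open_affine_proj_int by (intro at_within_open) auto
  ultimately show ?thesis by simp
qed

lemma psi_affine_deriv:
  assumes x: "affine_proj x \<in> int_simplex"
  shows "((\<lambda>x. \<psi> (affine_proj x)) has_derivative (\<lambda>u. grad (affine_proj x) \<bullet> u)) (at x)"
  using affine_chain[OF psi_deriv[OF x] x] by (simp add: simplex_deriv_center[OF x])

lemma grad_affine_deriv:
  assumes x: "affine_proj x \<in> int_simplex"
  shows "((\<lambda>x. grad (affine_proj x)) has_derivative hess_vec (affine_proj x)) (at x)"
  unfolding grad_def hess_vec_def[abs_def]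
  by (rule has_derivative_vecI) (simp add: affine_chain[OF simplex_deriv_deriv[OF x center_tangent] x])

lemma continuous_on_hess_vec: "continuous_on int_simplex (\<lambda>p. hess_vec p u)"
  unfolding hess_vec_def
  using C2 by (intro continuous_on_vec_lambda) (simp add: C2_on_int_simplex_def center_tangent)

lemma diff_tangent: "p \<bullet> 1 = 1 \<Longrightarrow> q \<bullet> 1 = 1 \<Longrightarrow> p - q \<in> tangent_simplex"
  by (simp add: tangent_simplex_iff inner_diff_left)

lemma bregman_eq:
  "q \<in> int_simplex \<Longrightarrow> p \<bullet> 1 = 1 \<Longrightarrow> bregman \<psi> p q = \<psi> p - \<psi> q - grad q \<bullet> (p - q)"
  by (simp add: bregman_def simplex_deriv_tangent diff_tangent int_simplex_sum)

lemma convex_prob_simplex: "convex (prob_simplex :: (real ^ 'a) set)"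
  using strict_conv by (simp add: strictly_convex_on_def)

lemma segment_int_simplex:
  assumes q: "q \<in> int_simplex" and p: "p \<in> prob_simplex" and e: "0 \<le> e" "e < 1"
  shows "(1 - e) *\<^sub>R q + e *\<^sub>R p \<in> int_simplex"
proof -
  have "0 < (1 - e) * q $ a + e * p $ a" for a
    using q p e by (intro add_pos_nonneg) (auto simp: int_simplex_def prob_simplex_def)
  then show ?thesis
    using q p by (simp add: int_simplex_def prob_simplex_def sum.distrib flip: sum_distrib_left)
qed

text \<open>Convexity bounds the difference quotients of \<open>\<psi>\<close> along the segment from \<open>q\<close> to \<open>p\<close> by its full increment. The
point \<open>p\<close> may lie on the boundary since all proper intermediate points are interior.\<close>

lemma gradient_inequality:
  assumes q: "q \<in> int_simplex" and p: "p \<in> prob_simplex"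
  shows "grad q \<bullet> (p - q) \<le> \<psi> p - \<psi> q"
proof -
  have q': "q \<in> prob_simplex" using q int_simplex_subset by blast
  let ?l = "\<lambda>e::real. q + e *\<^sub>R (p - q)" and ?I = "{0..<1::real}"
  have l_eq: "?l e = (1 - e) *\<^sub>R q + e *\<^sub>R p" for e by (simp add: algebra_simps)
  have l: "(?l has_derivative (\<lambda>e. e *\<^sub>R (p - q))) (at 0 within ?I)"
    by (auto intro!: derivative_eq_intros)
  have sub: "?l ` ?I \<subseteq> int_simplex" unfolding l_eq using segment_int_simplex[OF q p] by auto
  have "((\<lambda>e. \<psi> (?l e)) has_derivative (\<lambda>e. simplex_deriv \<psi> q (e *\<^sub>R (p - q)))) (at 0 within ?I)"
    by (rule has_derivative_in_compose[OF l]) (use has_derivative_subset[OF psi_deriv[OF q] sub] in simp)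
  moreover have "simplex_deriv \<psi> q (e *\<^sub>R (p - q)) = e * (grad q \<bullet> (p - q))" for e
    using diff_tangent[OF prob_simplex_sum[OF p] int_simplex_sum[OF q]] q
    by (simp add: simplex_deriv_tangent tangent_simplex_iff)
  ultimately have "((\<lambda>e. \<psi> (?l e)) has_field_derivative (grad q \<bullet> (p - q))) (at 0 within ?I)"
    by (simp add: has_field_derivative_def mult_commute_abs)
  then have lim: "((\<lambda>e. (\<psi> (?l e) - \<psi> q) / e) \<longlongrightarrow> grad q \<bullet> (p - q)) (at 0 within ?I)"
    by (simp add: has_field_derivative_iff)
  have ev: "eventually (\<lambda>e. (\<psi> (?l e) - \<psi> q) / e \<le> \<psi> p - \<psi> q) (at 0 within ?I)"
    unfolding eventually_at_filter
  proof (intro always_eventually allI impI)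
    fix e :: real assume e: "e \<noteq> 0" "e \<in> ?I"
    have "\<psi> (?l e) \<le> (1 - e) * \<psi> q + e * \<psi> p"
    proof (cases "p = q")
      case False
      then show ?thesis
        using strict_conv p q' e unfolding strictly_convex_on_def l_eq by (force intro: less_imp_le)
    qed (simp add: algebra_simps)
    then have "\<psi> (?l e) - \<psi> q \<le> (\<psi> p - \<psi> q) * e" by (simp only: algebra_simps)
    then show "(\<psi> (?l e) - \<psi> q) / e \<le> \<psi> p - \<psi> q"
      using e pos_divide_le_eq[of e "\<psi> (?l e) - \<psi> q" "\<psi> p - \<psi> q"] by simp
  qed
  have "at (0::real) within ?I \<noteq> bot"
  proof -
    have "?I - {0} = {0<..<1}" by auto
    then show ?thesis by (simp add: at_within_eq_bot_iff)
  qed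
  from tendsto_upperbound[OF lim ev this] show ?thesis .
qed

text \<open>The gradient inequality applied at the midpoint of \<open>p\<close> and \<open>q\<close>. The bound no longer involves the gradient of \<open>\<psi>\<close> at
\<open>q\<close>, which may blow up as \<open>q\<close> approaches the boundary, so it survives in limits.\<close>

lemma bregman_lower_bound:
  assumes q: "q \<in> int_simplex" and p: "p \<in> prob_simplex"
  shows "\<psi> p + \<psi> q - 2 * \<psi> ((1/2) *\<^sub>R (p + q)) \<le> bregman \<psi> p q"
proof -
  let ?m = "(1/2) *\<^sub>R (p + q)"
  have m: "?m \<in> prob_simplex"
    using segment_int_simplex[OF q p, of "1/2"] int_simplex_subset
    by (auto simp: scaleR_add_right add.commute)
  have "?m - q = (1/2) *\<^sub>R (p - q)" by (simp add: vec_eq_iff)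
  then have "grad q \<bullet> (p - q) \<le> 2 * (\<psi> ?m - \<psi> q)"
    using gradient_inequality[OF q m] by simp
  then show ?thesis by (simp add: bregman_eq[OF q prob_simplex_sum[OF p]])
qed

lemma midpoint_strict:
  assumes "p \<in> prob_simplex" "q \<in> prob_simplex" "p \<noteq> q"
  shows "0 < \<psi> p + \<psi> q - 2 * \<psi> ((1/2) *\<^sub>R (p + q))"
proof -
  have "\<psi> ((1 - u) *\<^sub>R p + u *\<^sub>R q) < (1 - u) * \<psi> p + u * \<psi> q" if "0 < u" "u < 1" for u
    using strict_conv assms that unfolding strictly_convex_on_def by blast
  from this[of "1/2"] show ?thesis by (simp add: scaleR_add_right)
qed

lemma bregman_pos: "q \<in> int_simplex \<Longrightarrow> p \<in> prob_simplex \<Longrightarrow> p \<noteq> q \<Longrightarrow> 0 < bregman \<psi> p q"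
  using midpoint_strict[of p q] bregman_lower_bound[of q p] int_simplex_subset by force

lemma bregman_self: "q \<in> int_simplex \<Longrightarrow> bregman \<psi> q q = 0"
  by (simp add: bregman_eq int_simplex_sum)

lemma bregman_nonneg: "q \<in> int_simplex \<Longrightarrow> p \<in> prob_simplex \<Longrightarrow> 0 \<le> bregman \<psi> p q"
  using bregman_pos[of q p] bregman_self[of q] by (cases "p = q") auto

lemma continuous_on_bregman:
  assumes "continuous_on prob_simplex \<psi>" "q \<in> int_simplex"
  shows "continuous_on prob_simplex (\<lambda>p. bregman \<psi> p q)"
proof (rule continuous_on_eq)
  show "continuous_on prob_simplex (\<lambda>p. \<psi> p - \<psi> q - grad q \<bullet> (p - q))"
    by (intro continuous_intros assms)
qed (simp add: bregman_eq assms prob_simplex_sum)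

text \<open>The vector representing the linear form \<open>g\<close> on the tangent space in the Hessian metric at \<open>p\<close>.\<close>

definition natural_grad :: "real ^ 'a \<Rightarrow> real ^ 'a \<Rightarrow> real ^ 'a" where
  "natural_grad p g = (THE v. v \<in> tangent_simplex \<and>
     (\<forall>w\<in>tangent_simplex. simplex_hess \<psi> p v w = g \<bullet> w))"

lemma natural_grad_ex1:
  assumes p: "p \<in> int_simplex"
  shows "\<exists>!v. v \<in> tangent_simplex \<and> (\<forall>w\<in>tangent_simplex. simplex_hess \<psi> p v w = g \<bullet> w)"
proof -
  \<comment> \<open>the second summand makes the Hessian, which is definite on tangent vectors only, definite everywhere\<close>
  let ?T = "\<lambda>u. hess_vec p u + (u \<bullet> 1) *\<^sub>R 1"
  have lin: "linear ?T"
    by (rule linearI)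
       (simp_all add: linear_add[OF linear_hess_vec[OF p]] linear_scale[OF linear_hess_vec[OF p]]
          inner_add_left algebra_simps)
  have "inj ?T"
    unfolding linear_injective_0[OF lin]
  proof (intro allI impI)
    fix u assume "?T u = 0"
    then have "?T u \<bullet> u = 0" by simp
    then have sum0: "hess_vec p u \<bullet> u + (u \<bullet> 1)\<^sup>2 = 0"
      by (simp only: inner_add_left inner_scaleR_left power2_eq_square inner_commute[of 1 u])
    then have "hess_vec p u \<bullet> u = 0" "(u \<bullet> 1)\<^sup>2 = 0"
      using hess_vec_nonneg[OF p, of u] zero_le_power2[of "u \<bullet> 1"] by linarith+
    then show "u = 0" using hess_vec_definite[OF p, of u] by (simp add: center_def)
  qed
  then have "surj ?T" by (rule linear_inj_imp_surj[OF lin])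
  then obtain u where u: "g = ?T u" by (auto simp: surj_def)
  have hess: "simplex_hess \<psi> p (center u) w = g \<bullet> w" if w: "w \<in> tangent_simplex" for w
    using hess_vec_inner[OF p, of u w] w u
    by (simp add: center_id inner_add_left tangent_simplex_iff inner_commute[of 1 w])
  show ?thesis
  proof (rule ex1I[of _ "center u"])
    fix v assume v: "v \<in> tangent_simplex \<and> (\<forall>w\<in>tangent_simplex. simplex_hess \<psi> p v w = g \<bullet> w)"
    let ?d = "v - center u"
    have d: "?d \<in> tangent_simplex"
      using v center_tangent[of u] by (simp add: tangent_simplex_iff inner_diff_left)
    have "linear (\<lambda>u. simplex_hess \<psi> p u ?d)"
      by (rule has_derivative_linear[OF simplex_deriv_deriv[OF p d]])
    from linear_diff[OF this, of v "center u"] have "simplex_hess \<psi> p ?d ?d = 0"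
      using v hess[OF d] d by (metis diff_self)
    then show "v = center u" using hess_pos p d by fastforce
  qed (use hess center_tangent in auto)
qed

lemma natural_grad_tangent: "p \<in> int_simplex \<Longrightarrow> natural_grad p g \<in> tangent_simplex"
  and natural_grad_hess:
    "p \<in> int_simplex \<Longrightarrow> w \<in> tangent_simplex \<Longrightarrow> simplex_hess \<psi> p (natural_grad p g) w = g \<bullet> w"
  using theI'[OF natural_grad_ex1] unfolding natural_grad_def by blast+

lemma natural_grad_unique:
  "p \<in> int_simplex \<Longrightarrow> v \<in> tangent_simplex \<Longrightarrow> (\<And>w. w \<in> tangent_simplex \<Longrightarrow> simplex_hess \<psi> p v w = g \<bullet> w)
    \<Longrightarrow> v = natural_grad p g"
  using natural_grad_ex1[of p g] natural_grad_tangent natural_grad_hess by blast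

end


section \<open>The gradient field\<close>

locale mirror_mdp = discounted_mdp P r \<gamma> + potential \<psi>
  for P :: "'s::finite \<Rightarrow> 'a::finite \<Rightarrow> 's pmf" and r :: "real ^ 'a ^ 's" and \<gamma> :: real
    and \<psi> :: "real ^ 'a \<Rightarrow> real"
begin

definition flow_field :: "real ^ 'a ^ 's \<Rightarrow> real ^ 'a ^ 's" where
  "flow_field \<pi> = (\<chi> s. natural_grad (\<pi> $ s) (q_fn \<pi> s))"

lemma int_policies_nth: "\<pi> \<in> int_policies \<Longrightarrow> \<pi> $ s \<in> int_simplex"
  by (simp add: int_policies_def)

lemma policies_nth: "\<pi> \<in> policies \<Longrightarrow> \<pi> $ s \<in> prob_simplex"
  by (simp add: policies_def)

text \<open>The occupancy weights appear both in the metric and in the derivative of the reward. Testing with directions supported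
in a single state cancels them, so the gradient is the same for all initial distributions under
which every state is visited.\<close>

lemma policy_gradient_eq_flow_field:
  assumes \<pi>: "\<pi> \<in> int_policies" and occ: "\<And>s. 0 < occ \<mu> \<pi> s"
  shows "policy_gradient P r \<gamma> \<mu> \<psi> \<pi> = flow_field \<pi>"
  unfolding policy_gradient_def
proof (rule the_equality)
  note p = int_policies_nth[OF \<pi>]
  have R': "frechet_derivative (total_reward P r \<gamma> \<mu>) (at \<pi> within int_policies) w
      = (\<Sum>s\<in>UNIV. occ \<mu> \<pi> s * (q_fn \<pi> s \<bullet> w $ s))" if "w \<in> tangent_policies" for w
    using total_reward_frechet_derivative[OF \<pi> that, of \<mu>] by (simp add: inner_commute)
  show "flow_field \<pi> \<in> tangent_policies \<and> (\<forall>w\<in>tangent_policies.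
      policy_metric P \<gamma> \<mu> \<psi> \<pi> (flow_field \<pi>) w
        = frechet_derivative (total_reward P r \<gamma> \<mu>) (at \<pi> within int_policies) w)"
    by (auto simp: R' policy_metric_def flow_field_def tangent_policies_def
        natural_grad_tangent[OF p] natural_grad_hess[OF p])
  fix v assume v: "v \<in> tangent_policies \<and> (\<forall>w\<in>tangent_policies.
      policy_metric P \<gamma> \<mu> \<psi> \<pi> v w
        = frechet_derivative (total_reward P r \<gamma> \<mu>) (at \<pi> within int_policies) w)"
  have "v $ s0 = natural_grad (\<pi> $ s0) (q_fn \<pi> s0)" for s0
  proof (rule natural_grad_unique[OF p])
    show vs: "v $ s \<in> tangent_simplex" for s using v by (simp add: tangent_policies_def)
    fix w :: "real ^ 'a" assume w: "w \<in> tangent_simplex"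
    let ?w = "(\<chi> s. if s = s0 then w else 0) :: real ^ 'a ^ 's"
    have w': "?w \<in> tangent_policies"
      using w by (simp add: tangent_policies_def tangent_simplex_def)
    have hess0: "simplex_hess \<psi> (\<pi> $ s) (v $ s) 0 = 0" for s
      using hess_vec_inner[OF p, of s "v $ s" 0] vs[of s]
      by (simp add: center_id linear_0[OF linear_center])
    have "policy_metric P \<gamma> \<mu> \<psi> \<pi> v ?w = (\<Sum>s\<in>UNIV. occ \<mu> \<pi> s * (q_fn \<pi> s \<bullet> ?w $ s))"
      by (rule trans[OF bspec[OF conjunct2[OF v] w'] R'[OF w']])
    then have "(\<Sum>s\<in>UNIV. occ \<mu> \<pi> s * simplex_hess \<psi> (\<pi> $ s) (v $ s) (?w $ s))
        = (\<Sum>s\<in>UNIV. occ \<mu> \<pi> s * (q_fn \<pi> s \<bullet> ?w $ s))"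
      unfolding policy_metric_def .
    moreover have "(\<Sum>s\<in>UNIV. occ \<mu> \<pi> s * simplex_hess \<psi> (\<pi> $ s) (v $ s) (?w $ s))
        = (\<Sum>s\<in>UNIV. if s = s0 then occ \<mu> \<pi> s * simplex_hess \<psi> (\<pi> $ s) (v $ s) w else 0)"
      by (intro sum.cong) (auto simp: hess0)
    moreover have "(\<Sum>s\<in>UNIV. occ \<mu> \<pi> s * (q_fn \<pi> s \<bullet> ?w $ s))
        = (\<Sum>s\<in>UNIV. if s = s0 then occ \<mu> \<pi> s * (q_fn \<pi> s \<bullet> w) else 0)"
      by (intro sum.cong) auto
    ultimately show "simplex_hess \<psi> (\<pi> $ s0) (v $ s0) w = q_fn \<pi> s0 \<bullet> w"
      using occ[of s0] by simp
  qed
  then show "v = flow_field \<pi>" by (simp add: flow_field_def vec_eq_iff)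
qed

section \<open>The divergence between policies\<close>

abbreviation pdiv :: "'s pmf \<Rightarrow> real ^ 'a ^ 's \<Rightarrow> real ^ 'a ^ 's \<Rightarrow> real" where
  "pdiv \<mu> \<equiv> policy_div P \<gamma> \<mu> \<psi>"

abbreviation rew :: "'s pmf \<Rightarrow> real ^ 'a ^ 's \<Rightarrow> real" where
  "rew \<mu> \<equiv> total_reward P r \<gamma> \<mu>"

lemma pdiv_term_nonneg:
  "\<pi> \<in> policies \<Longrightarrow> \<pi>' \<in> int_policies \<Longrightarrow> 0 \<le> occ \<mu> \<pi> s * bregman \<psi> (\<pi> $ s) (\<pi>' $ s)"
  by (intro mult_nonneg_nonneg occ_nonneg bregman_nonneg int_policies_nth policies_nth)

lemma pdiv_nonneg: "\<pi> \<in> policies \<Longrightarrow> \<pi>' \<in> int_policies \<Longrightarrow> 0 \<le> pdiv \<mu> \<pi> \<pi>'"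
  unfolding policy_div_def by (intro sum_nonneg pdiv_term_nonneg)

lemma pdiv_self: "\<pi> \<in> int_policies \<Longrightarrow> pdiv \<mu> \<pi> \<pi> = 0"
  by (simp add: policy_div_def bregman_self int_policies_nth)

text \<open>Vanishing divergence a priori gives equality only in the states visited by \<open>\<pi>\<close>. But then \<open>\<pi>\<close> and \<open>\<pi>'\<close> have the same
occupancy, and since \<open>\<pi>'\<close> visits every state, so does \<open>\<pi>\<close>.\<close>

lemma pdiv_eq_0:
  assumes \<pi>: "\<pi> \<in> policies" and \<pi>': "\<pi>' \<in> int_policies" and occ: "\<And>s. 0 < occ \<mu> \<pi>' s"
    and zero: "pdiv \<mu> \<pi> \<pi>' = 0"
  shows "\<pi> = \<pi>'"
proof -
  have term0: "occ \<mu> \<pi> s * bregman \<psi> (\<pi> $ s) (\<pi>' $ s) = 0" for s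
    using zero pdiv_term_nonneg[OF \<pi> \<pi>'] unfolding policy_div_def by (simp add: sum_nonneg_eq_0_iff)
  have visited: "\<pi> $ s = \<pi>' $ s" if "0 < occ \<mu> \<pi> s" for s
    using term0[of s] that bregman_pos[OF int_policies_nth[OF \<pi>'] policies_nth[OF \<pi>], of s s] by force
  have "occ \<mu> \<pi> = occ \<mu> \<pi>'"
    by (rule occ_cong_visited) (use \<pi> \<pi>' int_policies_subset visited in auto)
  then have "\<pi> $ s = \<pi>' $ s" for s using visited[of s] occ[of s] by simp
  then show ?thesis by (simp add: vec_eq_iff)
qed

lemma continuous_on_pdiv:
  assumes "continuous_on prob_simplex \<psi>" and \<pi>': "\<pi>' \<in> int_policies"
  shows "continuous_on policies (\<lambda>\<pi>. pdiv \<mu> \<pi> \<pi>')"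
proof -
  have "continuous_on policies (\<lambda>\<pi>. bregman \<psi> (\<pi> $ s) (\<pi>' $ s))" for s
    by (rule continuous_on_compose2[OF continuous_on_bregman[OF assms(1) int_policies_nth[OF \<pi>']]])
       (auto intro!: continuous_intros policies_nth)
  then show ?thesis unfolding policy_div_def by (intro continuous_intros continuous_on_occ)
qed

section \<open>The three-point identity and the central path\<close>

text \<open>The field is the one of \<open>policy_gradient_eq_flow_field\<close>, free of the initial distribution, so that facts about one
trajectory can be combined for several initial distributions.\<close>

definition flow_on :: "real set \<Rightarrow> (real \<Rightarrow> real ^ 'a ^ 's) \<Rightarrow> bool" where
  "flow_on I x \<longleftrightarrow> (\<forall>t\<in>I. x t \<in> int_policies \<and>
     (x has_vector_derivative flow_field (x t)) (at t within I))"

lemma flow_on_subset: "flow_on I x \<Longrightarrow> J \<subseteq> I \<Longrightarrow> flow_on J x"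
  unfolding flow_on_def by (meson has_vector_derivative_within_subset subsetD)

text \<open>The terms with the gradient of \<open>\<psi>\<close> cancel, leaving the Hessian applied to the velocity, which is the state-action
value by definition of the flow. The comparison point \<open>p\<close> may lie on the boundary.\<close>

lemma bregman_along_flow:
  assumes flow: "flow_on I x" and t: "t \<in> I" and p: "p \<bullet> 1 = 1"
  shows "((\<lambda>\<tau>. bregman \<psi> p (x \<tau> $ s)) has_field_derivative - (q_fn (x t) s \<bullet> (p - x t $ s)))
    (at t within I)"
proof -
  let ?y = "\<lambda>\<tau>. x \<tau> $ s"
  let ?v = "natural_grad (?y t) (q_fn (x t) s)"
  have int: "?y \<tau> \<in> int_simplex" if "\<tau> \<in> I" for \<tau>
    using flow that by (simp add: flow_on_def int_policies_nth)
  have aff: "affine_proj (?y \<tau>) = ?y \<tau>" if "\<tau> \<in> I" for \<tau>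
    by (rule affine_proj_id[OF int_simplex_sum[OF int[OF that]]])
  have "(x has_derivative (\<lambda>h. h *\<^sub>R flow_field (x t))) (at t within I)"
    using flow t by (simp add: flow_on_def has_vector_derivative_def)
  from bounded_linear.has_derivative[OF bounded_linear_vec_nth[of s] this]
  have y: "(?y has_derivative (\<lambda>h. h *\<^sub>R ?v)) (at t within I)"
    by (simp add: flow_field_def)
  have intt: "affine_proj (?y t) \<in> int_simplex" using int aff t by simp
  have 1: "((\<lambda>\<tau>. \<psi> (affine_proj (?y \<tau>))) has_derivative (\<lambda>h. grad (?y t) \<bullet> (h *\<^sub>R ?v))) (at t within I)"
    using has_derivative_compose[OF y psi_affine_deriv[OF intt]] by (simp add: aff[OF t])
  have 2: "((\<lambda>\<tau>. grad (affine_proj (?y \<tau>))) has_derivative (\<lambda>h. hess_vec (?y t) (h *\<^sub>R ?v))) (at t within I)"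
    using has_derivative_compose[OF y grad_affine_deriv[OF intt]] by (simp add: aff[OF t])
  have 3: "((\<lambda>\<tau>. \<psi> p - \<psi> (affine_proj (?y \<tau>)) - grad (affine_proj (?y \<tau>)) \<bullet> (p - ?y \<tau>)) has_derivative
      (\<lambda>h. 0 - grad (?y t) \<bullet> (h *\<^sub>R ?v)
         - (grad (affine_proj (?y t)) \<bullet> (0 - h *\<^sub>R ?v) + hess_vec (?y t) (h *\<^sub>R ?v) \<bullet> (p - ?y t)))) (at t within I)"
    by (intro has_derivative_diff has_derivative_inner has_derivative_const y 1 2)
  have tang: "p - ?y t \<in> tangent_simplex" by (rule diff_tangent[OF p int_simplex_sum[OF int[OF t]]])
  have "hess_vec (?y t) ?v \<bullet> (p - ?y t) = q_fn (x t) s \<bullet> (p - ?y t)"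
    using int[OF t] tang by (simp add: hess_vec_inner center_id natural_grad_tangent natural_grad_hess)
  then have 4: "(\<lambda>h. 0 - grad (?y t) \<bullet> (h *\<^sub>R ?v)
         - (grad (affine_proj (?y t)) \<bullet> (0 - h *\<^sub>R ?v) + hess_vec (?y t) (h *\<^sub>R ?v) \<bullet> (p - ?y t)))
      = (\<lambda>h. - (q_fn (x t) s \<bullet> (p - ?y t)) * h)"
    by (simp add: aff[OF t] linear_scale[OF linear_hess_vec[OF int[OF t]]] fun_eq_iff)
  have "((\<lambda>\<tau>. bregman \<psi> p (?y \<tau>)) has_derivative (\<lambda>h. - (q_fn (x t) s \<bullet> (p - ?y t)) * h)) (at t within I)"
    by (rule has_derivative_transform[OF t _ 3[unfolded 4]]) (simp add: aff bregman_eq int p)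
  then show ?thesis unfolding has_field_derivative_def .
qed

lemma pdiv_along_flow:
  assumes flow: "flow_on I x" and t: "t \<in> I" and \<pi>: "\<pi> \<in> policies"
  shows "((\<lambda>\<tau>. pdiv \<mu> \<pi> (x \<tau>)) has_field_derivative rew \<mu> (x t) - rew \<mu> \<pi>) (at t within I)"
proof -
  have xt: "x t \<in> policies" using flow t int_policies_subset by (auto simp: flow_on_def)
  have "((\<lambda>\<tau>. pdiv \<mu> \<pi> (x \<tau>)) has_field_derivative
      (\<Sum>s\<in>UNIV. occ \<mu> \<pi> s * - (q_fn (x t) s \<bullet> (\<pi> $ s - x t $ s)))) (at t within I)"
    unfolding policy_div_def
    by (intro DERIV_sum DERIV_cmult bregman_along_flow[OF flow t] prob_simplex_sum policies_nth \<pi>)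
  moreover have "(\<Sum>s\<in>UNIV. occ \<mu> \<pi> s * - (q_fn (x t) s \<bullet> (\<pi> $ s - x t $ s))) = rew \<mu> (x t) - rew \<mu> \<pi>"
    using performance_difference[OF xt \<pi>, of \<mu>] by (simp add: inner_commute sum_negf)
  ultimately show ?thesis by simp
qed

text \<open>The function \<open>?u\<close> below compares the divergences of \<open>\<pi>\<close> and of the endpoint \<open>x t\<close> from the moving point. Both are
differentiated with a fixed first argument, so the rewards along the path cancel, and no
integral of the reward along the path appears.\<close>

lemma three_point_identity:
  assumes flow: "flow_on {0..t} x" and t: "0 \<le> t" and \<pi>: "\<pi> \<in> policies"
  shows "t * (rew \<mu> \<pi> - rew \<mu> (x t)) = pdiv \<mu> \<pi> (x 0) - pdiv \<mu> \<pi> (x t) - pdiv \<mu> (x t) (x 0)"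
proof -
  have xt: "x t \<in> int_policies" using flow t by (simp add: flow_on_def)
  then have xt': "x t \<in> policies" using int_policies_subset by blast
  let ?u = "\<lambda>\<tau>. pdiv \<mu> \<pi> (x \<tau>) - pdiv \<mu> (x t) (x \<tau>) + \<tau> * (rew \<mu> \<pi> - rew \<mu> (x t))"
  have "(?u has_field_derivative 0) (at \<tau> within {0..t})" if \<tau>: "\<tau> \<in> {0..t}" for \<tau>
    by (rule DERIV_cong[OF DERIV_add[OF DERIV_diff[OF pdiv_along_flow[OF flow \<tau> \<pi>, of \<mu>]
          pdiv_along_flow[OF flow \<tau> xt', of \<mu>]]
        DERIV_cmult_right[OF DERIV_ident, of "rew \<mu> \<pi> - rew \<mu> (x t)"]]]) simp
  from has_field_derivative_zero_constant[OF convex_real_interval(5) this]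
  obtain c where c: "\<forall>\<tau>\<in>{0..t}. ?u \<tau> = c" by (rule exE)
  have "?u t = c" "?u 0 = c" by (rule bspec[OF c], use t in simp)+
  then show ?thesis by (simp add: pdiv_self[OF xt])
qed

text \<open>By the three-point identity the regularised objective at \<open>\<pi>\<close> falls short of its value at \<open>x t\<close> by exactly
\<open>pdiv \<mu> \<pi> (x t) / t\<close>.\<close>

lemma central_path:
  assumes flow: "flow_on {0..t} x" and t: "0 < t" and occ: "\<And>s. 0 < occ \<mu> (x t) s"
  shows "{\<pi>. is_arg_max (\<lambda>\<pi>. rew \<mu> \<pi> - inverse t * pdiv \<mu> \<pi> (x 0)) (\<lambda>\<pi>. \<pi> \<in> policies) \<pi>} = {x t}"
proof -
  have xt: "x t \<in> int_policies" using flow t by (simp add: flow_on_def)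
  then have xt': "x t \<in> policies" using int_policies_subset by blast
  let ?F = "\<lambda>\<pi>. rew \<mu> \<pi> - inverse t * pdiv \<mu> \<pi> (x 0)"
  have F: "?F \<pi> = ?F (x t) - inverse t * pdiv \<mu> \<pi> (x t)" if "\<pi> \<in> policies" for \<pi>
  proof -
    have "pdiv \<mu> \<pi> (x 0) = t * (rew \<mu> \<pi> - rew \<mu> (x t)) + pdiv \<mu> \<pi> (x t) + pdiv \<mu> (x t) (x 0)"
      using three_point_identity[OF flow less_imp_le[OF t] that, of \<mu>] by simp
    moreover have "inverse t * (t * y) = y" for y using t by (simp flip: mult.assoc)
    ultimately show ?thesis by (simp only: distrib_left)
  qed
  have less: "?F \<pi> < ?F (x t)" if \<pi>: "\<pi> \<in> policies" "\<pi> \<noteq> x t" for \<pi>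
  proof -
    have "0 < pdiv \<mu> \<pi> (x t)"
      using pdiv_nonneg[OF \<pi>(1) xt, of \<mu>] pdiv_eq_0[OF \<pi>(1) xt occ] \<pi>(2) by fastforce
    then show ?thesis using F[OF \<pi>(1)] t by simp
  qed
  show ?thesis
  proof (rule set_eqI, unfold mem_Collect_eq singleton_iff is_arg_max_def, rule iffI)
    fix \<pi> assume a: "\<pi> \<in> policies \<and> \<not> (\<exists>y. y \<in> policies \<and> ?F \<pi> < ?F y)"
    show "\<pi> = x t"
    proof (rule ccontr)
      assume "\<pi> \<noteq> x t"
      with a less have "?F \<pi> < ?F (x t)" by blast
      with a xt' show False by blast
    qed
  next
    fix \<pi> assume \<pi>: "\<pi> = x t"
    have "\<not> ?F (x t) < ?F y" if "y \<in> policies" for y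
      using less[OF that] by (cases "y = x t") auto
    with xt' show "\<pi> \<in> policies \<and> \<not> (\<exists>y. y \<in> policies \<and> ?F \<pi> < ?F y)" unfolding \<pi> by blast
  qed
qed

lemma reward_gap_bound:
  assumes flow: "flow_on {0..t} x" and t: "0 < t" and \<pi>: "\<pi> \<in> opt_policies P r \<gamma> \<mu>"
  shows "t * (opt_reward P r \<gamma> \<mu> - rew \<mu> (x t)) + pdiv \<mu> \<pi> (x t) = pdiv \<mu> \<pi> (x 0) - pdiv \<mu> (x t) (x 0)"
  using three_point_identity[OF flow less_imp_le[OF t], of \<pi> \<mu>] \<pi> by (simp add: opt_policies_def)

lemma sublinear_rate:
  assumes flow: "flow_on {0..t} x" and t: "0 < t"
  shows "0 \<le> opt_reward P r \<gamma> \<mu> - rew \<mu> (x t)"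
    and "opt_reward P r \<gamma> \<mu> - rew \<mu> (x t)
      \<le> ((INF \<pi>\<in>opt_policies P r \<gamma> \<mu>. pdiv \<mu> \<pi> (x 0)) - pdiv \<mu> (x t) (x 0)) / t"
    and "((INF \<pi>\<in>opt_policies P r \<gamma> \<mu>. pdiv \<mu> \<pi> (x 0)) - pdiv \<mu> (x t) (x 0)) / t
      \<le> (INF \<pi>\<in>opt_policies P r \<gamma> \<mu>. pdiv \<mu> \<pi> (x 0)) / t"
proof -
  have x: "x t \<in> int_policies" "x 0 \<in> int_policies" using flow t by (auto simp: flow_on_def)
  then have xt': "x t \<in> policies" using int_policies_subset by blast
  show "0 \<le> opt_reward P r \<gamma> \<mu> - rew \<mu> (x t)" using total_reward_le_opt[OF xt', of \<mu>] by simp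
  have "t * (opt_reward P r \<gamma> \<mu> - rew \<mu> (x t)) + pdiv \<mu> (x t) (x 0)
      \<le> (INF \<pi>\<in>opt_policies P r \<gamma> \<mu>. pdiv \<mu> \<pi> (x 0))"
  proof (rule cINF_greatest[OF opt_policies_nonempty])
    fix \<pi> assume \<pi>: "\<pi> \<in> opt_policies P r \<gamma> \<mu>"
    then have "0 \<le> pdiv \<mu> \<pi> (x t)" by (intro pdiv_nonneg x) (simp add: opt_policies_def)
    with reward_gap_bound[OF flow t \<pi>]
    show "t * (opt_reward P r \<gamma> \<mu> - rew \<mu> (x t)) + pdiv \<mu> (x t) (x 0) \<le> pdiv \<mu> \<pi> (x 0)" by simp
  qed
  then show "opt_reward P r \<gamma> \<mu> - rew \<mu> (x t)
      \<le> ((INF \<pi>\<in>opt_policies P r \<gamma> \<mu>. pdiv \<mu> \<pi> (x 0)) - pdiv \<mu> (x t) (x 0)) / t"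
    using t by (simp add: le_divide_eq mult.commute)
  show "((INF \<pi>\<in>opt_policies P r \<gamma> \<mu>. pdiv \<mu> \<pi> (x 0)) - pdiv \<mu> (x t) (x 0)) / t
      \<le> (INF \<pi>\<in>opt_policies P r \<gamma> \<mu>. pdiv \<mu> \<pi> (x 0)) / t"
    using t pdiv_nonneg[OF xt' x(2), of \<mu>] by (simp add: divide_right_mono)
qed

lemma pdiv_attains_min:
  assumes "continuous_on prob_simplex \<psi>" "\<pi>' \<in> int_policies"
  shows "\<exists>\<pi>. is_arg_min (\<lambda>\<pi>. pdiv \<mu> \<pi> \<pi>') (\<lambda>\<pi>. \<pi> \<in> opt_policies P r \<gamma> \<mu>) \<pi>"
proof -
  have sub: "opt_policies P r \<gamma> \<mu> \<subseteq> policies" by (auto simp: opt_policies_def)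
  have "compact (opt_policies P r \<gamma> \<mu>)"
  proof -
    have "closed (policies \<inter> rew \<mu> -` {opt_reward P r \<gamma> \<mu>})"
      by (rule continuous_closed_preimage[OF continuous_on_total_reward compact_imp_closed[OF compact_policies]]) simp
    moreover have "opt_policies P r \<gamma> \<mu> = policies \<inter> (policies \<inter> rew \<mu> -` {opt_reward P r \<gamma> \<mu>})"
      by (auto simp: opt_policies_def)
    ultimately show ?thesis using compact_Int_closed[OF compact_policies] by metis
  qed
  from continuous_attains_inf[OF this opt_policies_nonempty continuous_on_subset[OF continuous_on_pdiv[OF assms] sub], of \<mu>]
  show ?thesis unfolding is_arg_min_linorder by blast
qed

section \<open>Long-time limit\<close>

text \<open>At an optimal \<open>\<pi>\<close> the three-point identity gives \<open>pdiv \<mu> \<pi> (x t) \<le> pdiv \<mu> \<pi> (x 0) - pdiv \<mu> (x t) (x 0)\<close>. Along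
the times \<open>f n\<close> the right-hand side converges to \<open>pdiv \<mu> \<pi> (x 0) - pdiv \<mu> \<pi>s (x 0)\<close>, which is therefore
nonnegative. If \<open>\<pi>\<close> is a minimiser too, it is zero, and \<open>pdiv \<mu> \<pi> (x (f n))\<close> tends to zero. Since \<open>\<pi>s\<close> may
be a boundary policy, at which \<open>\<psi>\<close> need not be differentiable, equality is deduced from the
midpoint bound \<open>bregman_lower_bound\<close>.\<close>

lemma cluster_point:
  assumes cont: "continuous_on prob_simplex \<psi>" and flow: "flow_on {0..} x"
    and f: "filterlim f at_top sequentially" and lim: "(\<lambda>n. x (f n)) \<longlonglongrightarrow> \<pi>s"
  shows "\<pi>s \<in> opt_policies P r \<gamma> \<mu>"
    and "\<pi> \<in> opt_policies P r \<gamma> \<mu> \<Longrightarrow> pdiv \<mu> \<pi>s (x 0) \<le> pdiv \<mu> \<pi> (x 0)"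
    and "\<pi> \<in> opt_policies P r \<gamma> \<mu> \<Longrightarrow> pdiv \<mu> \<pi> (x 0) \<le> pdiv \<mu> \<pi>s (x 0) \<Longrightarrow> 0 < occ \<mu> \<pi>s s
      \<Longrightarrow> \<pi> $ s = \<pi>s $ s"
proof -
  have flow': "flow_on {0..t} x" for t by (rule flow_on_subset[OF flow]) auto
  have int: "x t \<in> int_policies" if "0 \<le> t" for t using flow that by (simp add: flow_on_def)
  have fpos: "eventually (\<lambda>n. 0 < f n) sequentially"
    using f by (simp add: filterlim_at_top_dense)
  have in_pol: "eventually (\<lambda>n. x (f n) \<in> policies) sequentially"
    using fpos by eventually_elim (use int int_policies_subset in force)
  have \<pi>s: "\<pi>s \<in> policies"
    by (rule Lim_in_closed_set[OF compact_imp_closed[OF compact_policies] in_pol _ lim]) simp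
  have limD: "(\<lambda>n. pdiv \<mu> (x (f n)) (x 0)) \<longlonglongrightarrow> pdiv \<mu> \<pi>s (x 0)"
    by (rule continuous_on_tendsto_compose[OF continuous_on_pdiv[OF cont int] lim \<pi>s in_pol]) simp
  have limR: "(\<lambda>n. rew \<mu> (x (f n))) \<longlonglongrightarrow> rew \<mu> \<pi>s"
    by (rule continuous_on_tendsto_compose[OF continuous_on_total_reward lim \<pi>s in_pol])
  obtain \<pi>1 where \<pi>1: "\<pi>1 \<in> opt_policies P r \<gamma> \<mu>" using opt_policies_nonempty by blast
  have "opt_reward P r \<gamma> \<mu> - rew \<mu> \<pi>s \<le> 0"
  proof (rule tendsto_le)
    show "(\<lambda>n. opt_reward P r \<gamma> \<mu> - rew \<mu> (x (f n))) \<longlonglongrightarrow> opt_reward P r \<gamma> \<mu> - rew \<mu> \<pi>s"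
      by (intro tendsto_intros limR)
    show "(\<lambda>n. pdiv \<mu> \<pi>1 (x 0) * inverse (f n)) \<longlonglongrightarrow> 0"
      using tendsto_mult[OF tendsto_const tendsto_inverse_0_at_top[OF f], of "pdiv \<mu> \<pi>1 (x 0)"] by simp
    show "eventually (\<lambda>n. opt_reward P r \<gamma> \<mu> - rew \<mu> (x (f n)) \<le> pdiv \<mu> \<pi>1 (x 0) * inverse (f n)) sequentially"
      using fpos
    proof eventually_elim
      case (elim n)
      have "0 \<le> pdiv \<mu> \<pi>1 (x (f n))" "0 \<le> pdiv \<mu> (x (f n)) (x 0)"
        using elim \<pi>1 int int_policies_subset by (auto intro!: pdiv_nonneg simp: opt_policies_def)
      then show ?case
        using reward_gap_bound[OF flow' elim \<pi>1] elim by (simp add: field_simps)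
    qed
  qed simp
  then show opt: "\<pi>s \<in> opt_policies P r \<gamma> \<mu>"
    using total_reward_le_opt[OF \<pi>s, of \<mu>] \<pi>s by (simp add: opt_policies_def)
  have gap: "eventually (\<lambda>n. pdiv \<mu> \<pi> (x (f n)) \<le> pdiv \<mu> \<pi> (x 0) - pdiv \<mu> (x (f n)) (x 0)) sequentially"
    if \<pi>: "\<pi> \<in> opt_policies P r \<gamma> \<mu>" for \<pi>
    using fpos
  proof eventually_elim
    case (elim n)
    have "0 \<le> f n * (opt_reward P r \<gamma> \<mu> - rew \<mu> (x (f n)))"
      using elim int[of "f n"] int_policies_subset
      by (intro mult_nonneg_nonneg) (auto intro!: total_reward_le_opt)
    then show ?case using reward_gap_bound[OF flow' elim \<pi>] by linarith
  qed
  have nonneg: "eventually (\<lambda>n. 0 \<le> pdiv \<mu> \<pi> (x (f n))) sequentially"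
    if \<pi>: "\<pi> \<in> opt_policies P r \<gamma> \<mu>" for \<pi>
    using fpos by eventually_elim (use \<pi> int in \<open>auto intro!: pdiv_nonneg simp: opt_policies_def\<close>)
  have gap_lim: "(\<lambda>n. pdiv \<mu> \<pi> (x 0) - pdiv \<mu> (x (f n)) (x 0)) \<longlonglongrightarrow> pdiv \<mu> \<pi> (x 0) - pdiv \<mu> \<pi>s (x 0)" for \<pi>
    by (intro tendsto_intros limD)
  have min: "pdiv \<mu> \<pi>s (x 0) \<le> pdiv \<mu> \<pi> (x 0)" if \<pi>: "\<pi> \<in> opt_policies P r \<gamma> \<mu>" for \<pi>
  proof -
    have "0 \<le> pdiv \<mu> \<pi> (x 0) - pdiv \<mu> \<pi>s (x 0)"
    proof (rule tendsto_lowerbound[OF gap_lim])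
      show "eventually (\<lambda>n. 0 \<le> pdiv \<mu> \<pi> (x 0) - pdiv \<mu> (x (f n)) (x 0)) sequentially"
        using gap[OF \<pi>] nonneg[OF \<pi>] by eventually_elim linarith
    qed simp
    then show ?thesis by simp
  qed
  show "\<pi> \<in> opt_policies P r \<gamma> \<mu> \<Longrightarrow> pdiv \<mu> \<pi>s (x 0) \<le> pdiv \<mu> \<pi> (x 0)" by (rule min)
  assume \<pi>: "\<pi> \<in> opt_policies P r \<gamma> \<mu>" and le: "pdiv \<mu> \<pi> (x 0) \<le> pdiv \<mu> \<pi>s (x 0)"
  then have \<pi>': "\<pi> \<in> policies" by (simp add: opt_policies_def)
  have "pdiv \<mu> \<pi> (x 0) - pdiv \<mu> \<pi>s (x 0) = 0" using min[OF \<pi>] le by simp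
  with gap_lim[of \<pi>] have lim0: "(\<lambda>n. pdiv \<mu> \<pi> (x 0) - pdiv \<mu> (x (f n)) (x 0)) \<longlonglongrightarrow> 0" by simp
  have visited: "\<pi> $ s = \<pi>s $ s" if s: "0 < occ \<mu> \<pi> s" for s
  proof (rule ccontr)
    assume ne: "\<pi> $ s \<noteq> \<pi>s $ s"
    let ?J = "\<lambda>q. \<psi> (\<pi> $ s) + \<psi> q - 2 * \<psi> ((1/2) *\<^sub>R (\<pi> $ s + q))"
    have lims: "(\<lambda>n. x (f n) $ s) \<longlonglongrightarrow> \<pi>s $ s" by (intro tendsto_intros lim)
    have in_s: "eventually (\<lambda>n. x (f n) $ s \<in> prob_simplex) sequentially"
      using in_pol by eventually_elim (rule policies_nth)
    have mid: "(1/2) *\<^sub>R (\<pi> $ s + q) \<in> prob_simplex" if "q \<in> prob_simplex" for q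
      using convexD[OF convex_prob_simplex policies_nth[OF \<pi>', of s] that, of "1/2" "1/2"]
      by (simp add: scaleR_add_right)
    have in_mid: "eventually (\<lambda>n. (1/2) *\<^sub>R (\<pi> $ s + x (f n) $ s) \<in> prob_simplex) sequentially"
      using in_s by eventually_elim (rule mid)
    have "(\<lambda>n. \<psi> ((1/2) *\<^sub>R (\<pi> $ s + x (f n) $ s))) \<longlonglongrightarrow> \<psi> ((1/2) *\<^sub>R (\<pi> $ s + \<pi>s $ s))"
      by (rule continuous_on_tendsto_compose[OF cont _ mid[OF policies_nth[OF \<pi>s]] in_mid])
         (intro tendsto_intros lims)
    moreover have "(\<lambda>n. \<psi> (x (f n) $ s)) \<longlonglongrightarrow> \<psi> (\<pi>s $ s)"
      by (rule continuous_on_tendsto_compose[OF cont lims policies_nth[OF \<pi>s] in_s])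
    ultimately have "(\<lambda>n. occ \<mu> \<pi> s * ?J (x (f n) $ s)) \<longlonglongrightarrow> occ \<mu> \<pi> s * ?J (\<pi>s $ s)"
      by (intro tendsto_intros)
    moreover have "eventually (\<lambda>n. occ \<mu> \<pi> s * ?J (x (f n) $ s)
        \<le> pdiv \<mu> \<pi> (x 0) - pdiv \<mu> (x (f n)) (x 0)) sequentially"
      using fpos gap[OF \<pi>]
    proof eventually_elim
      case (elim n)
      then have xn: "x (f n) \<in> int_policies" by (intro int) simp
      have "occ \<mu> \<pi> s * ?J (x (f n) $ s) \<le> occ \<mu> \<pi> s * bregman \<psi> (\<pi> $ s) (x (f n) $ s)"
        using s by (intro mult_left_mono bregman_lower_bound int_policies_nth[OF xn] policies_nth[OF \<pi>']) simp
      also have "\<dots> \<le> pdiv \<mu> \<pi> (x (f n))"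
        unfolding policy_div_def by (rule member_le_sum) (use pdiv_term_nonneg[OF \<pi>' xn] in auto)
      finally show ?case using elim by simp
    qed
    ultimately have "occ \<mu> \<pi> s * ?J (\<pi>s $ s) \<le> 0"
      using lim0 by (intro tendsto_le[OF sequentially_bot])
    moreover have "0 < ?J (\<pi>s $ s)"
      using midpoint_strict[OF policies_nth[OF \<pi>'] policies_nth[OF \<pi>s] ne] .
    ultimately show False using s by (simp add: mult_le_0_iff)
  qed
  have "occ \<mu> \<pi> = occ \<mu> \<pi>s" by (rule occ_cong_visited[OF \<pi>' \<pi>s visited])
  then show "0 < occ \<mu> \<pi>s s \<Longrightarrow> \<pi> $ s = \<pi>s $ s" using visited[of s] by simp
qed

lemma occ_lower_bound: "\<pi> \<in> policies \<Longrightarrow> (1 - \<gamma>) * pmf \<mu> s \<le> occ \<mu> \<pi> s"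
  using occ_balance[of \<pi> \<mu> s] discount_nonneg
  by (simp add: sum_nonneg occ_nonneg step_prob_nonneg)

text \<open>Under the uniform initial distribution \<open>\<nu>\<close> every policy visits every state. Two cluster points are both
minimisers of the same divergence over the same set, and hence equal in every state; a
relatively compact trajectory with a single cluster point converges.\<close>

lemma flow_converges:
  assumes cont: "continuous_on prob_simplex \<psi>" and flow: "flow_on {0..} x"
  shows "\<exists>\<pi>s. (x \<longlongrightarrow> \<pi>s) at_top"
proof -
  define \<nu> :: "'s pmf" where "\<nu> = pmf_of_set UNIV"
  have \<nu>: "0 < occ \<nu> \<pi> s" if "\<pi> \<in> policies" for \<pi> s
  proof -
    have "0 < (1 - \<gamma>) * pmf \<nu> s" using discount_less_1 by (simp add: \<nu>_def)
    with occ_lower_bound[OF that, of \<nu> s] show ?thesis by linarith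
  qed
  have pol: "x t \<in> policies" if "0 \<le> t" for t
    using flow that int_policies_subset by (auto simp: flow_on_def)
  have cluster: "\<exists>\<pi>s f. filterlim f at_top sequentially \<and> (\<forall>n. \<exists>k. f n = g k) \<and> (\<lambda>n. x (f n)) \<longlonglongrightarrow> \<pi>s"
    if g: "filterlim g at_top sequentially" "\<And>n. 0 \<le> g n" for g :: "nat \<Rightarrow> real"
  proof -
    have "\<forall>n. x (g n) \<in> policies" using pol g(2) by blast
    from seq_compactE[OF compact_imp_seq_compact[OF compact_policies] this]
    obtain l and h :: "nat \<Rightarrow> nat" where h: "strict_mono h" "(\<lambda>n. x (g (h n))) \<longlonglongrightarrow> l"
      unfolding comp_def by blast
    have "filterlim (\<lambda>n. g (h n)) at_top sequentially"
      by (rule filterlim_compose[OF g(1) filterlim_subseq[OF h(1)]])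
    with h(2) show ?thesis by (intro exI[of _ l] exI[of _ "\<lambda>n. g (h n)"]) blast
  qed
  obtain \<pi>s f where f: "filterlim f at_top sequentially" "(\<lambda>n. x (f n)) \<longlonglongrightarrow> \<pi>s"
    using cluster[OF filterlim_real_sequentially] by auto
  have unique: "\<pi>s = \<pi>s'" if f': "filterlim f' at_top sequentially" "(\<lambda>n. x (f' n)) \<longlonglongrightarrow> \<pi>s'" for f' \<pi>s'
  proof -
    note c = cluster_point[OF cont flow f, where \<mu>=\<nu>] and c' = cluster_point[OF cont flow f', where \<mu>=\<nu>]
    have "\<pi>s' \<in> policies" using c'(1) by (simp add: opt_policies_def)
    then show ?thesis using c'(3)[OF c(1) c(2)[OF c'(1)] \<nu>] by (simp add: vec_eq_iff)
  qed
  have "(x \<longlongrightarrow> \<pi>s) at_top"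
  proof (rule tendstoI, rule ccontr)
    fix e :: real assume e: "0 < e" and "\<not> eventually (\<lambda>t. dist (x t) \<pi>s < e) at_top"
    then have "\<exists>t\<ge>N. e \<le> dist (x t) \<pi>s" for N :: real
      by (auto simp: eventually_at_top_linorder not_less)
    then have "\<forall>n::nat. \<exists>t. real n \<le> t \<and> e \<le> dist (x t) \<pi>s" by blast
    from choice[OF this] obtain g where g: "\<And>n::nat. real n \<le> g n \<and> e \<le> dist (x (g n)) \<pi>s" by blast
    have "filterlim g at_top sequentially"
      by (rule filterlim_at_top_mono[OF filterlim_real_sequentially]) (use g in auto)
    moreover have "0 \<le> g n" for n using g[of n] by linarith
    ultimately obtain \<pi>s' f' where f': "filterlim f' at_top sequentially" "\<And>n. \<exists>k. f' n = g k"
      "(\<lambda>n. x (f' n)) \<longlonglongrightarrow> \<pi>s'" using cluster[of g] by blast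
    have "e \<le> dist (x (f' n)) \<pi>s" for n using f'(2)[of n] g by metis
    moreover have "(\<lambda>n. dist (x (f' n)) \<pi>s) \<longlonglongrightarrow> dist \<pi>s' \<pi>s" by (intro tendsto_intros f'(3))
    ultimately have "e \<le> dist \<pi>s' \<pi>s" by (intro LIMSEQ_le_const) auto
    then show False using unique[OF f'(1,3)] e by simp
  qed
  then show ?thesis by blast
qed

end


section \<open>Local existence\<close>

context potential
begin

text \<open>The gradient of the perspective \<open>y \<mapsto> m * \<psi> (y / m)\<close>, where \<open>m\<close> is the total mass of \<open>y\<close>, at a point of the simplex,
extended to a neighbourhood through the affine projection. In occupancy coordinates the divergence between policies is the Bregman divergence of the sum of these
perspectives over the states.\<close>

definition perspective_grad :: "real ^ 'a \<Rightarrow> real ^ 'a" where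
  "perspective_grad y = grad (affine_proj y) + (\<psi> (affine_proj y) - grad (affine_proj y) \<bullet> affine_proj y) *\<^sub>R 1"

lemma perspective_grad_has_derivative:
  assumes y: "affine_proj y \<in> int_simplex"
  shows "(perspective_grad has_derivative (\<lambda>u. hess_vec (affine_proj y) u
    - (hess_vec (affine_proj y) u \<bullet> affine_proj y) *\<^sub>R 1)) (at y)"
proof -
  have "(perspective_grad has_derivative (\<lambda>u. hess_vec (affine_proj y) u
      + (grad (affine_proj y) \<bullet> u
         - (grad (affine_proj y) \<bullet> center u + hess_vec (affine_proj y) u \<bullet> affine_proj y)) *\<^sub>R 1)) (at y)"
    unfolding perspective_grad_def[abs_def]
    by (intro has_derivative_add has_derivative_scaleR_left has_derivative_diff has_derivative_inner
        grad_affine_deriv psi_affine_deriv affine_proj_has_derivative y)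
  then show ?thesis by (simp add: grad_inner_center[OF y])
qed

end

context mirror_mdp
begin

text \<open>A point \<open>x\<close> encodes a policy, through the affine projections of its rows, and a function on the
states, through their masses. The masses play the role of the Lagrange multipliers of the balance equation, so
\<open>dual_map x = dual_map \<pi>\<^sub>0 + t r\<close> is the optimality condition of the problem regularised with weight
\<open>1 / t\<close>: the gradient in occupancy coordinates has changed by \<open>t r\<close> up to a multiplier of the form
\<open>\<gamma> P V - V\<close>, where \<open>V\<close> is the change of the masses. Domain and codomain thus have the same dimension.\<close>

definition mass :: "real ^ 'a ^ 's \<Rightarrow> real ^ 's" where
  "mass x = (\<chi> s. x $ s \<bullet> 1)"

definition dual_map :: "real ^ 'a ^ 's \<Rightarrow> real ^ 'a ^ 's" where
  "dual_map x = (\<chi> s. perspective_grad (x $ s) + ((mass x $ s) *\<^sub>R 1 - \<gamma> *\<^sub>R next_mean (mass x) s))"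

definition dual_deriv :: "real ^ 'a ^ 's \<Rightarrow> real ^ 'a ^ 's \<Rightarrow> real ^ 'a ^ 's" where
  "dual_deriv x u = (\<chi> s. (hess_vec (affine_proj (x $ s)) (u $ s)
     - (hess_vec (affine_proj (x $ s)) (u $ s) \<bullet> affine_proj (x $ s)) *\<^sub>R 1)
     + ((mass u $ s) *\<^sub>R 1 - \<gamma> *\<^sub>R next_mean (mass u) s))"

definition dual_domain :: "(real ^ 'a ^ 's) set" where
  "dual_domain = {x. \<forall>s. affine_proj (x $ s) \<in> int_simplex}"

lemma linear_mass: "linear mass"
  by (rule linearI) (simp_all add: mass_def vec_eq_iff inner_add_left)

lemma open_dual_domain: "open dual_domain"
proof -
  have "dual_domain = (\<Inter>s. (\<lambda>x. x $ s) -` {y. affine_proj y \<in> int_simplex})"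
    by (auto simp: dual_domain_def)
  also have "open \<dots>" by (intro open_INT ballI open_vimage_vec_nth open_affine_proj_int) auto
  finally show ?thesis .
qed

lemma dual_map_has_derivative:
  assumes x: "x \<in> dual_domain" shows "(dual_map has_derivative dual_deriv x) (at x)"
proof (rule has_derivative_vecI)
  fix s
  have "linear (\<lambda>x. (mass x $ s) *\<^sub>R 1 - \<gamma> *\<^sub>R next_mean (mass x) s)"
    by (rule linearI)
       (simp_all add: linear_add[OF linear_mass] linear_scale[OF linear_mass]
          linear_add[OF linear_next_mean] linear_scale[OF linear_next_mean] algebra_simps)
  then have 1: "((\<lambda>x. (mass x $ s) *\<^sub>R 1 - \<gamma> *\<^sub>R next_mean (mass x) s) has_derivative
      (\<lambda>u. (mass u $ s) *\<^sub>R 1 - \<gamma> *\<^sub>R next_mean (mass u) s)) (at x)"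
    by (rule linear_imp_has_derivative)
  have aff: "affine_proj (x $ s) \<in> int_simplex" using x by (simp add: dual_domain_def)
  have nth: "((\<lambda>x. x $ s) has_derivative (\<lambda>u. u $ s)) (at x)"
    by (rule bounded_linear_imp_has_derivative[OF bounded_linear_vec_nth])
  show "((\<lambda>x. dual_map x $ s) has_derivative (\<lambda>u. dual_deriv x u $ s)) (at x)"
    unfolding dual_map_def dual_deriv_def vec_lambda_beta
    by (rule has_derivative_add[OF has_derivative_compose[OF nth perspective_grad_has_derivative[OF aff]] 1])
qed

text \<open>Averaging the equation over the actions with weights \<open>\<pi>\<close> removes the Hessian terms and leaves the Bellman
equation for \<open>mass u\<close> with reward \<open>\<rho>\<close>.\<close>

lemma dual_deriv_solution:
  assumes \<pi>: "\<pi> \<in> policies" and x: "\<And>s. affine_proj (x $ s) = \<pi> $ s" and u: "dual_deriv x u = \<rho>"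
  shows "mass u $ s = \<pi> $ s \<bullet> (\<rho> $ s + \<gamma> *\<^sub>R next_mean (mass u) s)"
proof -
  have "(1::real ^ 'a) \<bullet> \<pi> $ s = 1" using prob_simplex_sum[OF policies_nth[OF \<pi>]] by (simp add: inner_commute)
  then have "dual_deriv x u $ s \<bullet> \<pi> $ s = mass u $ s - \<gamma> * (\<pi> $ s \<bullet> next_mean (mass u) s)"
    by (simp add: dual_deriv_def x inner_add_left inner_diff_left inner_commute[of "next_mean (mass u) s"])
  then show ?thesis unfolding u by (simp add: inner_add_right inner_commute)
qed

text \<open>The homogeneous Bellman equation kills the mass of \<open>u\<close>; what remains is the Hessian, which is definite on
vectors of mass zero.\<close>

lemma dual_deriv_injective:
  assumes \<pi>: "\<pi> \<in> int_policies" and x: "\<And>s. affine_proj (x $ s) = \<pi> $ s" and u: "dual_deriv x u = 0"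
  shows "u = 0"
proof -
  have \<pi>': "\<pi> \<in> policies" using \<pi> int_policies_subset by blast
  have m: "mass u = 0"
    by (rule bellman_injective[OF \<pi>']) (use dual_deriv_solution[OF \<pi>' x u] in simp)
  have "u $ s = 0" for s
  proof -
    have us: "u $ s \<bullet> 1 = 0" using m by (simp add: mass_def vec_eq_iff)
    have "dual_deriv x u $ s \<bullet> u $ s = 0" using u by simp
    then have "hess_vec (\<pi> $ s) (u $ s) \<bullet> u $ s = 0"
      using us by (simp add: dual_deriv_def x m linear_0[OF linear_next_mean] inner_diff_left inner_commute[of 1])
    then show ?thesis
      using hess_vec_definite[OF int_policies_nth[OF \<pi>]] us by (fastforce simp: center_def)
  qed
  then show ?thesis by (simp add: vec_eq_iff)
qed

text \<open>The masses move with the value function as velocity, by uniqueness of solutions of the Bellman equation. Hence the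
multiplier terms complete the reward to the state-action value function up to a constant in each
state, which tangent vectors do not see.\<close>

lemma dual_deriv_reward:
  assumes \<pi>: "\<pi> \<in> int_policies" and x: "\<And>s. affine_proj (x $ s) = \<pi> $ s" and u: "dual_deriv x u = r"
  shows "(\<chi> s. center (u $ s)) = flow_field \<pi>"
proof -
  have \<pi>': "\<pi> \<in> policies" using \<pi> int_policies_subset by blast
  have V: "mass u = value_fn \<pi>"
    by (rule value_fn_unique[OF \<pi>' dual_deriv_solution[OF \<pi>' x u]])
  have "center (u $ s) = natural_grad (\<pi> $ s) (q_fn \<pi> s)" for s
  proof (rule natural_grad_unique[OF int_policies_nth[OF \<pi>] center_tangent])
    fix w :: "real ^ 'a" assume w: "w \<in> tangent_simplex"
    have "dual_deriv x u $ s = r $ s" using u by simp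
    then have "hess_vec (\<pi> $ s) (u $ s)
        = q_fn \<pi> s + (hess_vec (\<pi> $ s) (u $ s) \<bullet> \<pi> $ s - mass u $ s) *\<^sub>R 1"
      by (simp add: dual_deriv_def x q_fn_def V algebra_simps)
    then have "hess_vec (\<pi> $ s) (u $ s) \<bullet> w
        = (q_fn \<pi> s + (hess_vec (\<pi> $ s) (u $ s) \<bullet> \<pi> $ s - mass u $ s) *\<^sub>R 1) \<bullet> w"
      by (rule arg_cong)
    also have "\<dots> = q_fn \<pi> s \<bullet> w"
      using w by (simp add: inner_add_left tangent_simplex_iff inner_commute[of 1])
    finally show "simplex_hess \<psi> (\<pi> $ s) (center (u $ s)) w = q_fn \<pi> s \<bullet> w"
      using hess_vec_inner[OF int_policies_nth[OF \<pi>], of s "u $ s" w] w by (simp add: center_id)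
  qed
  then show ?thesis by (simp add: flow_field_def)
qed

text \<open>The inverse \<open>g\<close> of \<open>dual_map\<close> near \<open>\<pi>0\<close> maps the segment from \<open>dual_map \<pi>0\<close> in direction \<open>r\<close> to a curve
whose projection to policies solves the flow.\<close>

lemma local_existence:
  assumes \<pi>0: "\<pi>0 \<in> int_policies"
  shows "\<exists>\<epsilon>>0. \<exists>x. x 0 = \<pi>0 \<and> flow_on {0..<\<epsilon>} x"
proof -
  have bl: "bounded_linear (dual_deriv x)" if "x \<in> dual_domain" for x
    using dual_map_has_derivative[OF that] by (rule has_derivative_bounded_linear)
  let ?f' = "\<lambda>x. Blinfun (dual_deriv x)"
  have app: "blinfun_apply (?f' x) = dual_deriv x" if "x \<in> dual_domain" for x
    by (rule bounded_linear_Blinfun_apply[OF bl[OF that]])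
  have aff0: "affine_proj (\<pi>0 $ s) = \<pi>0 $ s" for s
    by (rule affine_proj_id[OF int_simplex_sum[OF int_policies_nth[OF \<pi>0]]])
  have dom0: "\<pi>0 \<in> dual_domain" by (simp add: dual_domain_def aff0 int_policies_nth[OF \<pi>0])
  have cont_nth: "continuous_on dual_domain (\<lambda>x. affine_proj (x $ s))" for s
    by (rule continuous_on_compose2[OF continuous_on_affine_proj[of UNIV]]) (auto intro!: continuous_intros)
  have cont_hess: "continuous_on dual_domain (\<lambda>x. hess_vec (affine_proj (x $ s)) v)" for s v
    by (rule continuous_on_compose2[OF continuous_on_hess_vec cont_nth]) (auto simp: dual_domain_def)
  have cont_deriv: "continuous_on dual_domain (\<lambda>x. dual_deriv x u)" for u
    unfolding dual_deriv_def
    by (intro continuous_on_vec_lambda continuous_intros cont_hess cont_nth)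
  have cont: "continuous_on dual_domain ?f'"
  proof (rule continuous_on_blinfun_componentwise)
    fix i :: "real ^ 'a ^ 's"
    show "continuous_on dual_domain (\<lambda>x. blinfun_apply (?f' x) i)"
      by (rule continuous_on_eq[OF cont_deriv]) (simp add: app)
  qed
  have lin0: "linear (dual_deriv \<pi>0)" by (rule bounded_linear.linear[OF bl[OF dom0]])
  have "inj (dual_deriv \<pi>0)"
    unfolding linear_injective_0[OF lin0] using dual_deriv_injective[OF \<pi>0 aff0] by blast
  from linear_injective_left_inverse[OF lin0 this]
  obtain g0 where g0: "linear g0" "g0 \<circ> dual_deriv \<pi>0 = id" by blast
  have inv0: "Blinfun g0 o\<^sub>L ?f' \<pi>0 = id_blinfun"
  proof (rule blinfun_eqI)
    fix v
    have "blinfun_apply (Blinfun g0) = g0"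
      using g0(1) by (intro bounded_linear_Blinfun_apply) (simp add: linear_conv_bounded_linear)
    then show "blinfun_apply (Blinfun g0 o\<^sub>L ?f' \<pi>0) v = blinfun_apply id_blinfun v"
      using fun_cong[OF g0(2), of v] by (simp add: app[OF dom0])
  qed
  have der: "(dual_map has_derivative blinfun_apply (?f' x)) (at x)" if "x \<in> dual_domain" for x
    unfolding app[OF that] by (rule dual_map_has_derivative[OF that])
  obtain U' V g g' where U': "U' \<subseteq> dual_domain" "\<pi>0 \<in> U'" and V: "open V" "dual_map \<pi>0 \<in> V"
    and hom: "homeomorphism U' V dual_map g"
    and g: "\<And>y. y \<in> V \<Longrightarrow> (g has_derivative g' y) (at y)"
    and g': "\<And>y. y \<in> V \<Longrightarrow> g' y = inv (blinfun_apply (?f' (g y)))"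
    and bij: "\<And>y. y \<in> V \<Longrightarrow> bij (blinfun_apply (?f' (g y)))"
    using inverse_function_theorem[OF open_dual_domain der cont dom0 inv0] by metis
  let ?c = "\<lambda>t::real. dual_map \<pi>0 + t *\<^sub>R r"
  have "open (?c -` V)" by (intro open_vimage V continuous_intros)
  moreover have "0 \<in> ?c -` V" using V by simp
  ultimately obtain \<epsilon> where \<epsilon>: "\<epsilon> > 0" "ball 0 \<epsilon> \<subseteq> ?c -` V" by (meson open_contains_ball)
  let ?z = "\<lambda>t. g (?c t)"
  let ?x = "\<lambda>t. \<chi> s. affine_proj (?z t $ s)"
  have z0: "g (dual_map \<pi>0) = \<pi>0" by (rule homeomorphism_apply1[OF hom U'(2)])
  have "?x t \<in> int_policies \<and> (?x has_vector_derivative flow_field (?x t)) (at t within {0..<\<epsilon>})"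
    if t: "t \<in> {0..<\<epsilon>}" for t
  proof -
    have "t \<in> ball 0 \<epsilon>" using t by (simp add: dist_real_def)
    then have ct: "?c t \<in> V" using \<epsilon>(2) by blast
    have dom: "?z t \<in> dual_domain"
      using homeomorphism_image2[OF hom] ct U'(1) by blast
    then have int: "?x t \<in> int_policies" by (simp add: dual_domain_def int_policies_def)
    let ?u = "g' (?c t) r"
    have bij': "bij (dual_deriv (?z t))" using bij[OF ct] by (simp add: app[OF dom])
    have u: "dual_deriv (?z t) ?u = r"
      using g'[OF ct] surj_f_inv_f[OF bij_is_surj[OF bij'], of r] by (simp add: app[OF dom])
    have c: "(?c has_derivative (\<lambda>h. h *\<^sub>R r)) (at t)" by (auto intro!: derivative_eq_intros)
    have z: "(?z has_derivative (\<lambda>h. g' (?c t) (h *\<^sub>R r))) (at t)"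
      by (rule has_derivative_compose[OF c g[OF ct]])
    have lin: "linear (g' (?c t))" by (rule has_derivative_linear[OF g[OF ct]])
    have "(?x has_derivative (\<lambda>h. h *\<^sub>R flow_field (?x t))) (at t)"
    proof (rule has_derivative_vecI)
      fix s
      have "(\<chi> s. center (?u $ s)) = flow_field (?x t)" by (rule dual_deriv_reward[OF int _ u]) simp
      then have f: "flow_field (?x t) $ s = center (?u $ s)" by (metis vec_lambda_beta)
      have "((\<lambda>\<tau>. affine_proj (?z \<tau> $ s)) has_derivative (\<lambda>h. center (g' (?c t) (h *\<^sub>R r) $ s))) (at t)"
        by (rule has_derivative_compose[OF bounded_linear.has_derivative[OF bounded_linear_vec_nth z]
            affine_proj_has_derivative])
      then show "((\<lambda>\<tau>. ?x \<tau> $ s) has_derivative (\<lambda>h. (h *\<^sub>R flow_field (?x t)) $ s)) (at t)"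
        by (simp add: f linear_scale[OF lin] linear_scale[OF linear_center])
    qed
    then show ?thesis
      using int by (simp add: has_vector_derivative_def has_derivative_at_withinI)
  qed
  moreover have "?x 0 = \<pi>0" by (simp add: z0 aff0 vec_eq_iff)
  ultimately show ?thesis using \<epsilon>(1) by (auto simp: flow_on_def intro!: exI[of _ \<epsilon>] exI[of _ ?x])
qed

lemma gradient_flow_iff:
  assumes occ: "\<And>\<pi> s. \<pi> \<in> int_policies \<Longrightarrow> 0 < occ \<mu> \<pi> s"
  shows "gradient_flow P r \<gamma> \<mu> \<psi> \<pi>0 T x \<longleftrightarrow> 0 < T \<and> x 0 = \<pi>0 \<and> flow_on {t. 0 \<le> t \<and> ereal t < T} x"
  unfolding gradient_flow_def flow_on_def
  using policy_gradient_eq_flow_field[OF _ occ] by (auto simp: has_vector_derivative_def)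

lemma gradient_flow_up_to:
  assumes "flow_on {t. 0 \<le> t \<and> ereal t < T} x" "ereal t < T"
  shows "flow_on {0..t} x"
  by (rule flow_on_subset[OF assms(1)]) (auto intro: le_less_trans[OF _ assms(2)])

end

section \<open>Central path, rate and implicit bias\<close>

theorem theorem5p4:
  fixes P :: "'s::finite \<Rightarrow> 'a::finite \<Rightarrow> 's pmf"
    and r :: "real ^ 'a ^ 's"
    and \<gamma> :: real
    and \<mu> :: "'s pmf"
    and \<psi> :: "real ^ 'a \<Rightarrow> real"
    and \<pi>\<^sub>0 :: "real ^ 'a ^ 's"
  defines "R \<equiv> total_reward P r \<gamma> \<mu>"
    and "d \<equiv> state_occupancy P \<gamma> \<mu>"
    and "D \<equiv> policy_div P \<gamma> \<mu> \<psi>"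
    and "Rstar \<equiv> opt_reward P r \<gamma> \<mu>"
    and "Pistar \<equiv> opt_policies P r \<gamma> \<mu>"
    and "flow \<equiv> gradient_flow P r \<gamma> \<mu> \<psi> \<pi>\<^sub>0"
  assumes discount: "0 \<le> \<gamma>" "\<gamma> < 1"
    and exploration: "\<forall>\<pi>\<in>int_policies. \<forall>s. 0 < d \<pi> s"
    and strict_conv: "strictly_convex_on prob_simplex \<psi>"
    and C2: "C2_on_int_simplex \<psi>"
    and hess_pos: "\<forall>p\<in>int_simplex. \<forall>v\<in>tangent_simplex. v \<noteq> 0 \<longrightarrow> 0 < simplex_hess \<psi> p v v"
    and init: "\<pi>\<^sub>0 \<in> int_policies"
  shows
    \<comment> \<open>the supremum \<open>Rstar\<close> is a maximum\<close>
    "(\<exists>\<pi>\<in>policies. R \<pi> = Rstar) \<and> (\<forall>\<pi>\<in>policies. R \<pi> \<le> Rstar)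
     \<comment> \<open>well-posedness\<close>
   \<and> (\<exists>T x. flow T x)
   \<and> (\<forall>T T' x y. flow T x \<longrightarrow> flow T' y \<longrightarrow>
        (\<forall>t. 0 \<le> t \<and> ereal t < min T T' \<longrightarrow> x t = y t))
     \<comment> \<open>central path property\<close>
   \<and> (\<forall>T x. flow T x \<longrightarrow> (\<forall>t. 0 < t \<and> ereal t < T \<longrightarrow>
        {\<pi>. is_arg_max (\<lambda>\<pi>. R \<pi> - inverse t * D \<pi> \<pi>\<^sub>0) (\<lambda>\<pi>. \<pi> \<in> policies) \<pi>} = {x t}))
     \<comment> \<open>sublinear convergence\<close>
   \<and> (\<forall>T x. flow T x \<longrightarrow> (\<forall>t. 0 < t \<and> ereal t < T \<longrightarrow>
        0 \<le> Rstar - R (x t) \<and>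
        Rstar - R (x t) \<le> ((INF \<pi>\<in>Pistar. D \<pi> \<pi>\<^sub>0) - D (x t) \<pi>\<^sub>0) / t \<and>
        ((INF \<pi>\<in>Pistar. D \<pi> \<pi>\<^sub>0) - D (x t) \<pi>\<^sub>0) / t \<le> (INF \<pi>\<in>Pistar. D \<pi> \<pi>\<^sub>0) / t))
     \<comment> \<open>the infimum above is a minimum\<close>
   \<and> (continuous_on prob_simplex \<psi> \<longrightarrow>
        (\<exists>\<pi>. is_arg_min (\<lambda>\<pi>. D \<pi> \<pi>\<^sub>0) (\<lambda>\<pi>. \<pi> \<in> Pistar) \<pi>))
     \<comment> \<open>implicit bias; the minimiser is unique up to the states it never visits\<close>
   \<and> (continuous_on prob_simplex \<psi> \<longrightarrow>
        (\<forall>x. flow \<infinity> x \<longrightarrow>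
          (\<exists>\<pi>s. (x \<longlongrightarrow> \<pi>s) at_top \<and>
             is_arg_min (\<lambda>\<pi>. D \<pi> \<pi>\<^sub>0) (\<lambda>\<pi>. \<pi> \<in> Pistar) \<pi>s \<and>
             (\<forall>\<pi>'. is_arg_min (\<lambda>\<pi>. D \<pi> \<pi>\<^sub>0) (\<lambda>\<pi>. \<pi> \<in> Pistar) \<pi>' \<longrightarrow>
                (\<forall>s. 0 < d \<pi>s s \<longrightarrow> \<pi>' $ s = \<pi>s $ s)))))"
proof -
  interpret mirror_mdp P r \<gamma> \<psi>
    by unfold_locales (fact discount strict_conv C2 hess_pos)+
  note defs = R_def d_def D_def Rstar_def Pistar_def flow_def
  have occ: "0 < occ \<mu> \<pi> s" if "\<pi> \<in> int_policies" for \<pi> s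
    using exploration that by (simp add: d_def)
  have flow_iff: "flow T x \<longleftrightarrow> 0 < T \<and> x 0 = \<pi>\<^sub>0 \<and> flow_on {t. 0 \<le> t \<and> ereal t < T} x" for T x
    unfolding flow_def by (rule gradient_flow_iff[OF occ])
  have upto: "flow_on {0..t} x" "x 0 = \<pi>\<^sub>0" if "flow T x" "ereal t < T" for T x t
    using that gradient_flow_up_to by (auto simp: flow_iff)
  have central: "{\<pi>. is_arg_max (\<lambda>\<pi>. R \<pi> - inverse t * D \<pi> \<pi>\<^sub>0) (\<lambda>\<pi>. \<pi> \<in> policies) \<pi>} = {x t}"
    if "flow T x" "0 < t" "ereal t < T" for T x t
  proof -
    have fl: "flow_on {0..t} x" "x 0 = \<pi>\<^sub>0" by (rule upto[OF that(1,3)])+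
    then have "x t \<in> int_policies" using that(2) by (simp add: flow_on_def)
    from central_path[OF fl(1) that(2) occ[OF this]] show ?thesis by (simp add: defs fl(2))
  qed
  have maximum: "(\<exists>\<pi>\<in>policies. R \<pi> = Rstar) \<and> (\<forall>\<pi>\<in>policies. R \<pi> \<le> Rstar)"
    using opt_policies_nonempty[of \<mu>] total_reward_le_opt unfolding defs by (auto simp: opt_policies_def)
  have existence: "\<exists>T x. flow T x"
  proof -
    obtain \<epsilon> x where "\<epsilon> > 0" "x 0 = \<pi>\<^sub>0" "flow_on {0..<\<epsilon>} x" using local_existence[OF init] by blast
    moreover have "{t. 0 \<le> t \<and> ereal t < ereal \<epsilon>} = {0..<\<epsilon>}" by auto
    ultimately have "flow (ereal \<epsilon>) x" by (simp add: flow_iff)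
    then show ?thesis by blast
  qed
  have uniqueness: "x t = y t"
    if f: "flow T x" "flow T' y" and t: "0 \<le> t" "ereal t < min T T'" for T T' x y t
  proof (cases "t = 0")
    case True
    then show ?thesis using f by (simp add: flow_iff)
  next
    case False
    \<comment> \<open>both points are the only maximiser of the same regularised objective\<close>
    then have "{x t} = {y t}" using central[OF f(1), of t] central[OF f(2), of t] t by simp
    then show ?thesis by simp
  qed
  have rate: "0 \<le> Rstar - R (x t) \<and>
        Rstar - R (x t) \<le> ((INF \<pi>\<in>Pistar. D \<pi> \<pi>\<^sub>0) - D (x t) \<pi>\<^sub>0) / t \<and>
        ((INF \<pi>\<in>Pistar. D \<pi> \<pi>\<^sub>0) - D (x t) \<pi>\<^sub>0) / t \<le> (INF \<pi>\<in>Pistar. D \<pi> \<pi>\<^sub>0) / t"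
    if "flow T x" "0 < t" "ereal t < T" for T x t
    using sublinear_rate[OF upto(1)[OF that(1,3)] that(2), of \<mu>]
    unfolding defs upto(2)[OF that(1,3)] by blast
  have minimum: "\<exists>\<pi>. is_arg_min (\<lambda>\<pi>. D \<pi> \<pi>\<^sub>0) (\<lambda>\<pi>. \<pi> \<in> Pistar) \<pi>"
    if "continuous_on prob_simplex \<psi>"
    unfolding defs by (rule pdiv_attains_min[OF that init])
  have bias: "\<exists>\<pi>s. (x \<longlongrightarrow> \<pi>s) at_top \<and>
             is_arg_min (\<lambda>\<pi>. D \<pi> \<pi>\<^sub>0) (\<lambda>\<pi>. \<pi> \<in> Pistar) \<pi>s \<and>
             (\<forall>\<pi>'. is_arg_min (\<lambda>\<pi>. D \<pi> \<pi>\<^sub>0) (\<lambda>\<pi>. \<pi> \<in> Pistar) \<pi>' \<longrightarrow>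
                (\<forall>s. 0 < d \<pi>s s \<longrightarrow> \<pi>' $ s = \<pi>s $ s))"
    if cont: "continuous_on prob_simplex \<psi>" and fl: "flow \<infinity> x" for x
  proof -
    have fl': "flow_on {0..} x" "x 0 = \<pi>\<^sub>0" using fl by (simp_all add: flow_iff atLeast_def)
    obtain \<pi>s where lim: "(x \<longlongrightarrow> \<pi>s) at_top" using flow_converges[OF cont fl'(1)] by blast
    note c = cluster_point[OF cont fl'(1) filterlim_real_sequentially
        filterlim_compose[OF lim filterlim_real_sequentially], where \<mu>=\<mu>, unfolded fl'(2)]
    have min: "is_arg_min (\<lambda>\<pi>. D \<pi> \<pi>\<^sub>0) (\<lambda>\<pi>. \<pi> \<in> Pistar) \<pi>s"
      unfolding is_arg_min_linorder defs using c(1,2) by blast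
    moreover have "\<pi>' $ s = \<pi>s $ s"
      if "is_arg_min (\<lambda>\<pi>. D \<pi> \<pi>\<^sub>0) (\<lambda>\<pi>. \<pi> \<in> Pistar) \<pi>'" "0 < d \<pi>s s" for \<pi>' s
      using that c(1) unfolding is_arg_min_linorder defs by (intro c(3)) auto
    ultimately show ?thesis using lim by blast
  qed
  show ?thesis
    using maximum existence uniqueness central rate minimum bias by blast
qed

end
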